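(* In the setting of the context, let $\mathbf X=(I+\boldsymbol{\mathcal B}K)(\boldsymbol{\mathcal A}\mathbf X_0+\boldsymbol{\mathcal D}W)$, let $x_N$ be its last block of size $n_x$, and let $\tilde x_N=x_N-\mathbb E[x_N]$. Let $\mu_N\in\mathbb R^{n_x}$ and let $\Sigma_N\in\mathbb R^{n_x\times n_x}$ be symmetric with $\Sigma_N\succ0$. Then the terminal constraints $$\mathbb E[x_N]=\mu_N\qquad\text{and}\qquad \mathbb E[\tilde x_N\tilde x_N^\top]\preceq\Sigma_N$$ can be formulated, respectively, as the (equivalent) constraints $$\mu_N=\mathbf E_N(I+\boldsymbol{\mathcal B}K)\boldsymbol{\mathcal A}\boldsymbol\mu_0,$$ $$1-\big\|(\boldsymbol{\mathcal A}\mathbf\Sigma_0\boldsymbol{\mathcal A}^\top+\boldsymbol{\mathcal D}\boldsymbol{\mathcal D}^\top)^{1/2}(I+\boldsymbol{\mathcal B}K)^\top\mathbf E_N^\top\Sigma_N^{-1/2}\big\|_2\ge0,$$ where $\mathbf E_N=[0,\dots,0,I_{n_x}]\in\mathbb R^{n_x\times(N+2)n_x}$ and $\|\cdot\|_2$ is the matrix 2-norm (largest singular value).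
   Context: Fix positive integers $N,n_x,n_u,n_w$ and real matrices $A_k\in\mathbb R^{n_x\times n_x}$, $B_k\in\mathbb R^{n_x\times n_u}$, $D_k\in\mathbb R^{n_x\times n_w}$, $k=0,\dots,N-1$ (the data of the linear system $x_{k+1}=A_kx_k+B_ku_k+D_kw_k$). Define $\mathcal A\in\mathbb R^{(N+1)n_x\times n_x}$, $\mathcal B\in\mathbb R^{(N+1)n_x\times Nn_u}$, $\mathcal D\in\mathbb R^{(N+1)n_x\times Nn_w}$ blockwise, with block rows $i=0,\dots,N$ and block columns $j=0,\dots,N-1$: the $i$-th block of $\mathcal A$ is $A_{i-1}A_{i-2}\cdots A_0$ (and $I_{n_x}$ for $i=0$); the $(i,j)$ block of $\mathcal B$ is $A_{i-1}A_{i-2}\cdots A_{j+1}B_j$ if $j<i$ (equal to $B_{i-1}$ if $j=i-1$) and $0$ if $j\ge i$; $\mathcal D$ is defined likewise with $D_j$ in place of $B_j$. So the system reads $X=\mathcal Ax_0+\mathcal BU+\mathcal DW$, with $X,U,W$ the stacked states $x_0,\dots,x_N$, inputs $u_0,\dots,u_{N-1}$ and noises $w_0,\dots,w_{N-1}$. Augmented matrices: $\boldsymbol{\mathcal A}=\mathrm{blkdiag}(I_{n_x},\mathcal A)\in\mathbb R^{(N+2)n_x\times 2n_x}$, $\boldsymbol{\mathcal B}=\begin{bmatrix}0\\ \mathcal B\end{bmatrix}\in\mathbb R^{(N+2)n_x\times Nn_u}$, $\boldsymbol{\mathcal D}=\begin{bmatrix}0\\ \mathcal D\end{bmatrix}\in\mathbb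 R^{(N+2)n_x\times Nn_w}$, where the zero blocks have $n_x$ rows. Randomness: $x_0\sim\mathcal N(\mu_0,\Sigma_0)$ with $\Sigma_0\succeq0$; $W$ is Gaussian with $\mathbb E[W]=0$, $\mathbb E[WW^\top]=I_{Nn_w}$ and $\mathbb E[x_0W^\top]=0$. $\mathbf X_0=[\mathbb 1_{n_x}^\top,x_0^\top]^\top$ with $\mathbb 1_{n_x}$ the all-ones vector; its mean is $\boldsymbol\mu_0=\begin{bmatrix}\mathbb 1_{n_x}\\ \mu_0\end{bmatrix}$ and its covariance is $\mathbf\Sigma_0=\begin{bmatrix}0&0\\0&\Sigma_0\end{bmatrix}$. $K=[K_{\mathbb 1},K_X]\in\mathbb R^{Nn_u\times(N+2)n_x}$ is the control gain matrix, with $K_{\mathbb 1}\in\mathbb R^{Nn_u\times n_x}$ and $K_X\in\mathbb R^{Nn_u\times(N+1)n_x}$ lower block triangular (blocks of size $n_u\times n_x$; block $(i,j)$ is zero for $j>i$); the control input is $U=K(\boldsymbol{\mathcal A}\mathbf X_0+\boldsymbol{\mathcal D}W)$ and $\mathbf X=[\mathbb 1_{n_x}^\top,X^\top]^\top$. $M^{1/2}$ is the symmetric positive semidefinite square root of $M\succeq0$, and $\Sigma_N^{-1/2}=(\Sigma_N^{1/2})^{-1}$; $\preceq$ is the Loewner order. *)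

theory Defs
  imports
    "HOL-Probability.Probability"
    "Jordan_Normal_Form.Gauss_Jordan_Elimination"
    "Jordan_Normal_Form.Char_Poly"
begin

(* The dimensions N * n_x etc. are products of numbers fixed inside the statement, so the
   carrier-based matrices and vectors are used here and the type-indexed ones are hidden. *)
hide_type (open) Finite_Cartesian_Product.vec
hide_const (open) Finite_Cartesian_Product.vec Finite_Cartesian_Product.mat
  Finite_Cartesian_Product.row Finite_Cartesian_Product.column Determinants.det
no_notation inner (infix "\<bullet>" 70)
no_notation vec_nth (infixl "$" 90)

section \<open>Matrices\<close>

definition append_cols :: "real mat \<Rightarrow> real mat \<Rightarrow> real mat" where
  "append_cols P Q =
     four_block_mat P Q (0\<^sub>m 0 (dim_col P)) (0\<^sub>m 0 (dim_col Q))"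

(* p * q blocks F i j, each of size r * c; block indices start at 0 *)
definition block_mat :: "nat \<Rightarrow> nat \<Rightarrow> nat \<Rightarrow> nat \<Rightarrow> (nat \<Rightarrow> nat \<Rightarrow> real mat) \<Rightarrow> real mat" where
  "block_mat p q r c F =
     mat (p * r) (q * c) (\<lambda>(a, b). F (a div r) (b div c) $$ (a mod r, b mod c))"

(* Blocks of size r * c; the block containing entry (a, b) is (a div r, b div c). *)
definition lower_block_triangular :: "nat \<Rightarrow> nat \<Rightarrow> real mat \<Rightarrow> bool" where
  "lower_block_triangular r c P \<longleftrightarrow>
     (\<forall>a<dim_row P. \<forall>b<dim_col P. b div c > a div r \<longrightarrow> P $$ (a, b) = 0)"

definition outer_prod :: "real vec \<Rightarrow> real vec \<Rightarrow> real mat" where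
  "outer_prod v w = mat (dim_vec v) (dim_vec w) (\<lambda>(i, j). v $ i * w $ j)"

definition pos_semidef :: "nat \<Rightarrow> real mat \<Rightarrow> bool" where
  "pos_semidef n P \<longleftrightarrow> P \<in> carrier_mat n n \<and> transpose_mat P = P \<and>
     (\<forall>v\<in>carrier_vec n. v \<bullet> (P *\<^sub>v v) \<ge> 0)"

definition pos_def :: "nat \<Rightarrow> real mat \<Rightarrow> bool" where
  "pos_def n P \<longleftrightarrow> P \<in> carrier_mat n n \<and> transpose_mat P = P \<and>
     (\<forall>v\<in>carrier_vec n. v \<noteq> 0\<^sub>v n \<longrightarrow> v \<bullet> (P *\<^sub>v v) > 0)"

definition loewner_le :: "nat \<Rightarrow> real mat \<Rightarrow> real mat \<Rightarrow> bool" where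
  "loewner_le n P Q \<longleftrightarrow> P \<in> carrier_mat n n \<and> Q \<in> carrier_mat n n \<and> pos_semidef n (Q - P)"

definition psd_sqrt :: "real mat \<Rightarrow> real mat" where
  "psd_sqrt P = (THE S. pos_semidef (dim_row P) S \<and> S * S = P)"

definition inv_sqrt :: "real mat \<Rightarrow> real mat" where
  "inv_sqrt P = the (mat_inverse (psd_sqrt P))"

(* The singular values of P are the square roots of the eigenvalues of P^T P
   (up to additional zeros, which do not affect the maximum). *)
definition matrix_norm2 :: "real mat \<Rightarrow> real" where
  "matrix_norm2 P = Max {s. s \<ge> 0 \<and> eigenvalue (transpose_mat P * P) (s\<^sup>2)}"

section \<open>Random vectors\<close>

definition random_vec :: "'a measure \<Rightarrow> nat \<Rightarrow> ('a \<Rightarrow> real vec) \<Rightarrow> bool" where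
  "random_vec M n X \<longleftrightarrow> (\<forall>\<omega>\<in>space M. X \<omega> \<in> carrier_vec n) \<and>
     (\<forall>i<n. (\<lambda>\<omega>. X \<omega> $ i) \<in> borel_measurable M)"

definition expectation_vec :: "'a measure \<Rightarrow> nat \<Rightarrow> ('a \<Rightarrow> real vec) \<Rightarrow> real vec" where
  "expectation_vec M n X = vec n (\<lambda>i. integral\<^sup>L M (\<lambda>\<omega>. X \<omega> $ i))"

definition expectation_mat ::
    "'a measure \<Rightarrow> nat \<Rightarrow> nat \<Rightarrow> ('a \<Rightarrow> real mat) \<Rightarrow> real mat" where
  "expectation_mat M m n Z = mat m n (\<lambda>(i, j). integral\<^sup>L M (\<lambda>\<omega>. Z \<omega> $$ (i, j)))"

(* Univariate normal law; the point masses (variance 0) are included. *)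
definition gaussian_var :: "'a measure \<Rightarrow> ('a \<Rightarrow> real) \<Rightarrow> bool" where
  "gaussian_var M Y \<longleftrightarrow>
     (\<exists>m s. s > 0 \<and> distributed M lborel Y (normal_density m s)) \<or>
     Y \<in> borel_measurable M \<and> (\<exists>m. AE \<omega> in M. Y \<omega> = m)"

(* A random vector is Gaussian iff every linear combination of its components is;
   this allows a singular covariance matrix. *)
definition gaussian_vec :: "'a measure \<Rightarrow> nat \<Rightarrow> ('a \<Rightarrow> real vec) \<Rightarrow> bool" where
  "gaussian_vec M n X \<longleftrightarrow> random_vec M n X \<and>
     (\<forall>a\<in>carrier_vec n. gaussian_var M (\<lambda>\<omega>. a \<bullet> X \<omega>))"

definition normal_vec ::
    "'a measure \<Rightarrow> nat \<Rightarrow> ('a \<Rightarrow> real vec) \<Rightarrow> real vec \<Rightarrow> real mat \<Rightarrow> bool" where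
  "normal_vec M n X \<mu> \<Sigma> \<longleftrightarrow> gaussian_vec M n X \<and> expectation_vec M n X = \<mu> \<and>
     expectation_mat M n n (\<lambda>\<omega>. outer_prod (X \<omega> - \<mu>) (X \<omega> - \<mu>)) = \<Sigma>"

section \<open>The stacked linear system\<close>

(* trans_mat n A j i = A (i - 1) * ... * A j, the identity if i \<le> j *)
fun trans_mat :: "nat \<Rightarrow> (nat \<Rightarrow> real mat) \<Rightarrow> nat \<Rightarrow> nat \<Rightarrow> real mat" where
  "trans_mat n A j 0 = 1\<^sub>m n"
| "trans_mat n A j (Suc i) = (if j \<le> i then A i * trans_mat n A j i else 1\<^sub>m n)"

definition state_mat :: "nat \<Rightarrow> nat \<Rightarrow> (nat \<Rightarrow> real mat) \<Rightarrow> real mat" where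
  "state_mat N nx A = block_mat (N + 1) 1 nx nx (\<lambda>i _. trans_mat nx A 0 i)"

(* m is the number of columns of the matrices B k; also used with the noise matrices D k *)
definition input_mat ::
    "nat \<Rightarrow> nat \<Rightarrow> nat \<Rightarrow> (nat \<Rightarrow> real mat) \<Rightarrow> (nat \<Rightarrow> real mat) \<Rightarrow> real mat" where
  "input_mat N nx m A B = block_mat (N + 1) N nx m
     (\<lambda>i j. if j < i then trans_mat nx A (j + 1) i * B j else 0\<^sub>m nx m)"

definition aug_state_mat :: "nat \<Rightarrow> nat \<Rightarrow> (nat \<Rightarrow> real mat) \<Rightarrow> real mat" where
  "aug_state_mat N nx A = diag_block_mat [1\<^sub>m nx, state_mat N nx A]"

definition aug_input_mat ::
    "nat \<Rightarrow> nat \<Rightarrow> nat \<Rightarrow> (nat \<Rightarrow> real mat) \<Rightarrow> (nat \<Rightarrow> real mat) \<Rightarrow> real mat" where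
  "aug_input_mat N nx m A B = 0\<^sub>m nx (N * m) @\<^sub>r input_mat N nx m A B"

definition ones_vec :: "nat \<Rightarrow> real vec" where
  "ones_vec n = vec n (\<lambda>_. 1)"

definition last_block_mat :: "nat \<Rightarrow> nat \<Rightarrow> real mat" where
  "last_block_mat N nx = append_cols (0\<^sub>m nx ((N + 1) * nx)) (1\<^sub>m nx)"

end

theory Submission
  imports Defs
begin

text \<open>
  Write \<open>A, B, D\<close> for the augmented matrices and put \<open>G = E\<^sub>N (I + B K)\<close>, so that \<open>x\<^sub>N = G A X\<^sub>0 + G D W\<close>. Linearity of expectation gives the mean
  \<open>G A \<mu>\<^sub>0\<close>, and since \<open>x\<^sub>0\<close> and \<open>W\<close> are uncorrelated the covariance is \<open>G S G\<^sup>T\<close> with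
  \<open>S = A \<Sigma>\<^sub>0 A\<^sup>T + D D\<^sup>T\<close>. For
  \<open>X = S\<^sup>1\<^sup>/\<^sup>2 G\<^sup>T \<Sigma>\<^sub>N\<^sup>-\<^sup>1\<^sup>/\<^sup>2\<close> one has \<open>X\<^sup>T X = \<Sigma>\<^sub>N\<^sup>-\<^sup>1\<^sup>/\<^sup>2 (G S G\<^sup>T) \<Sigma>\<^sub>N\<^sup>-\<^sup>1\<^sup>/\<^sup>2\<close>, hence \<open>G S G\<^sup>T \<preceq> \<Sigma>\<^sub>N\<close> iff
  \<open>X\<^sup>T X \<preceq> I\<close>, iff all eigenvalues of \<open>X\<^sup>T X\<close> are at most \<open>1\<close>. Square roots and the last equivalence
  come from the spectral theorem for real symmetric matrices, which follows by deflating with a Householder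
  reflection.
\<close>

section \<open>Real symmetric matrices\<close>

lemma symmetric_scalar_prod_swap:
  fixes A :: "real mat"
  assumes "A \<in> carrier_mat n n" "transpose_mat A = A" "v \<in> carrier_vec n" "w \<in> carrier_vec n"
  shows "v \<bullet> (A *\<^sub>v w) = w \<bullet> (A *\<^sub>v v)"
  using transpose_vec_mult_scalar[of A n n w v] comm_scalar_prod[of "A *\<^sub>v v" n w] assms by auto

lemma scalar_prod_self_real:
  fixes v :: "real vec"
  shows "v \<bullet> v \<ge> 0" "v \<in> carrier_vec n \<Longrightarrow> v \<bullet> v = 0 \<longleftrightarrow> v = 0\<^sub>v n"
proof -
  have "conjugate v = v" by (rule eq_vecI) auto
  thus "v \<in> carrier_vec n \<Longrightarrow> v \<bullet> v = 0 \<longleftrightarrow> v = 0\<^sub>v n"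
    using conjugate_square_eq_0_vec[of v n] by simp
  show "v \<bullet> v \<ge> 0" by (simp add: scalar_prod_def sum_nonneg)
qed

text \<open>The fundamental theorem of algebra gives a complex eigenpair \<open>z\<close>,
  \<open>w\<close>. Symmetry forces \<open>z\<close> to be real, and then the real and imaginary
  parts of \<open>w\<close> satisfy the eigenvector equation separately; at least one of them is
  nonzero.\<close>

lemma symmetric_mat_has_eigenvector:
  fixes A :: "real mat"
  assumes A: "A \<in> carrier_mat n n" "transpose_mat A = A" and n: "n > 0"
  obtains e v where "v \<in> carrier_vec n" "v \<noteq> 0\<^sub>v n" "A *\<^sub>v v = e \<cdot>\<^sub>v v"
proof -
  define C where "C = map_mat complex_of_real A"
  have C: "C \<in> carrier_mat n n" using A by (auto simp: C_def)
  have "degree (char_poly C) \<noteq> 0" using degree_monic_char_poly[OF C] n by auto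
  then obtain z where "poly (char_poly C) z = 0"
    using fundamental_theorem_of_algebra constant_degree by metis
  hence "eigenvalue C z" using eigenvalue_root_char_poly[OF C] by auto
  then obtain w where w: "w \<in> carrier_vec n" "w \<noteq> 0\<^sub>v n" "C *\<^sub>v w = z \<cdot>\<^sub>v w"
    unfolding eigenvalue_def eigenvector_def using C by auto
  define a where "a = map_vec Re w"
  define b where "b = map_vec Im w"
  have a: "a \<in> carrier_vec n" and b: "b \<in> carrier_vec n" using w by (auto simp: a_def b_def)
  have comp: "(C *\<^sub>v w) $ i = (\<Sum>j<n. complex_of_real (A $$ (i,j)) * w $ j)" if "i < n" for i
    using that A w(1) by (auto simp: C_def scalar_prod_def lessThan_atLeast0)
  have compA: "(A *\<^sub>v u) $ i = (\<Sum>j<n. A $$ (i,j) * u $ j)" if "i < n" "u \<in> carrier_vec n" for i u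
    using that A by (auto simp: scalar_prod_def lessThan_atLeast0)
  have Aa: "A *\<^sub>v a = Re z \<cdot>\<^sub>v a - Im z \<cdot>\<^sub>v b"
  proof
    fix i assume "i < dim_vec (Re z \<cdot>\<^sub>v a - Im z \<cdot>\<^sub>v b)"
    hence i: "i < n" using b by auto
    have "(A *\<^sub>v a) $ i = Re ((C *\<^sub>v w) $ i)"
      using i w(1) by (simp add: comp compA a a_def)
    thus "(A *\<^sub>v a) $ i = (Re z \<cdot>\<^sub>v a - Im z \<cdot>\<^sub>v b) $ i"
      using i w a b by (simp add: a_def b_def)
  qed (use A b in auto)
  have Ab: "A *\<^sub>v b = Re z \<cdot>\<^sub>v b + Im z \<cdot>\<^sub>v a"
  proof
    fix i assume "i < dim_vec (Re z \<cdot>\<^sub>v b + Im z \<cdot>\<^sub>v a)"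
    hence i: "i < n" using a by auto
    have "(A *\<^sub>v b) $ i = Im ((C *\<^sub>v w) $ i)"
      using i w(1) by (simp add: comp compA b b_def)
    thus "(A *\<^sub>v b) $ i = (Re z \<cdot>\<^sub>v b + Im z \<cdot>\<^sub>v a) $ i"
      using i w a b by (simp add: a_def b_def)
  qed (use A a in auto)
  have ab: "a \<noteq> 0\<^sub>v n \<or> b \<noteq> 0\<^sub>v n"
  proof (rule ccontr)
    assume "\<not> ?thesis"
    hence "w $ i = 0" if "i < n" for i
      using that w(1) by (auto simp: a_def b_def vec_eq_iff complex_eq_iff)
    thus False using w by auto
  qed
  have "b \<bullet> (A *\<^sub>v a) = a \<bullet> (A *\<^sub>v b)" using symmetric_scalar_prod_swap[OF A b a] .
  moreover have "a \<bullet> b = b \<bullet> a" using comm_scalar_prod[OF a b] .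
  \<comment> \<open>Expanding with \<open>Aa\<close> and \<open>Ab\<close>, the terms with
    \<open>Re z\<close> cancel, and what remains carries the factor \<open>Im z\<close>.\<close>
  ultimately have "Im z * (a \<bullet> a + b \<bullet> b) = 0"
    using a b by (simp add: Aa Ab scalar_prod_minus_distrib[of _ n] scalar_prod_add_distrib[of _ n] algebra_simps)
  moreover have "a \<bullet> a + b \<bullet> b > 0"
    using ab scalar_prod_self_real(1)[of a] scalar_prod_self_real(1)[of b]
      scalar_prod_self_real(2)[OF a] scalar_prod_self_real(2)[OF b] by linarith
  ultimately have "Im z = 0" by auto
  hence "A *\<^sub>v a = Re z \<cdot>\<^sub>v a" "A *\<^sub>v b = Re z \<cdot>\<^sub>v b"
    using Aa Ab a b by (auto simp: vec_eq_iff)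
  thus ?thesis using ab a b that by blast
qed

text \<open>\<open>H\<close> is the Householder reflection exchanging \<open>v\<close> and the first unit vector.\<close>

lemma orthogonal_mat_first_col:
  fixes v :: "real vec"
  assumes v: "v \<in> carrier_vec n" "v \<bullet> v = 1" and n: "n > 0"
  obtains H where "H \<in> carrier_mat n n" "transpose_mat H = H" "H * H = 1\<^sub>m n" "col H 0 = v"
proof (cases "v = unit_vec n 0")
  case True
  \<comment> \<open>The formula of the other case divides by the squared distance between
    \<open>v\<close> and the first unit vector; where the two agree, the identity serves
    instead.\<close>
  show ?thesis by (rule that[of "1\<^sub>m n"]) (use True n in auto)
next
  case False
  define e :: "nat \<Rightarrow> real" where "e i = (if i = 0 then 1 else 0)" for i
  define u where "u i = v $ i - e i" for i
  define s where "s = (\<Sum>i<n. u i * u i)"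
  have vv: "(\<Sum>i<n. v $ i * v $ i) = 1"
    using v by (simp add: scalar_prod_def lessThan_atLeast0)
  \<comment> \<open>Both vectors have length 1, so their squared distance is 2 minus twice the first
    entry of \<open>v\<close>. This value of \<open>s\<close> is what makes \<open>v\<close> the
    first column of \<open>H\<close>.\<close>
  have s: "s = - 2 * u 0"
  proof -
    have "s = (\<Sum>i<n. v $ i * v $ i) - 2 * (\<Sum>i<n. v $ i * e i) + (\<Sum>i<n. e i * e i)"
      by (simp add: s_def u_def algebra_simps sum.distrib sum_subtractf sum_distrib_left)
    also have "(\<Sum>i<n. v $ i * e i) = v $ 0" using n by (simp add: e_def sum.delta if_distrib cong: if_cong)
    also have "(\<Sum>i<n. e i * e i) = 1" using n by (simp add: e_def sum.delta if_distrib cong: if_cong)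
    finally show ?thesis by (simp add: vv u_def e_def)
  qed
  have s0: "s \<noteq> 0"
  proof
    assume "s = 0"
    hence "\<forall>i<n. u i = 0" by (auto simp: s_def sum_nonneg_eq_0_iff)
    hence "v = unit_vec n 0" using v n by (auto simp: u_def e_def vec_eq_iff unit_vec_def)
    with False show False by simp
  qed
  \<comment> \<open>This is I - 2 u u^T / (u^T u), the reflection in the hyperplane orthogonal to
    \<open>u\<close>.\<close>
  define H where "H = mat n n (\<lambda>(i,j). (if i = j then 1 else 0) - 2 * u i * u j / s)"
  have Hc: "H \<in> carrier_mat n n" by (simp add: H_def)
  have "H * H = 1\<^sub>m n"
  proof
    fix i j assume "i < dim_row (1\<^sub>m n :: real mat)" "j < dim_col (1\<^sub>m n :: real mat)"
    hence ij: "i < n" "j < n" by auto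
    have "(H * H) $$ (i,j) = (\<Sum>k<n. ((if i = k then 1 else 0) - 2 * u i * u k / s) * ((if k = j then 1 else 0) - 2 * u k * u j / s))"
      using ij by (simp add: H_def scalar_prod_def lessThan_atLeast0)
    \<comment> \<open>Multiplied out with the Kronecker deltas evaluated: two sums supported at one
      index, and a multiple of the sum defining \<open>s\<close>.\<close>
    also have "\<dots> = (\<Sum>k<n. (if i = k then (if i = j then 1 else 0) - 2 * u i * u j / s else 0)
        + (if k = j then - 2 * u i * u j / s else 0) + 4 * u i * u j / s\<^sup>2 * (u k * u k))"
      by (rule sum.cong) (auto simp: algebra_simps power2_eq_square)
    also have "\<dots> = (if i = j then 1 else 0) - 2 * u i * u j / s - 2 * u i * u j / s + 4 * u i * u j / s\<^sup>2 * s"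
      using ij unfolding sum.distrib sum_distrib_left[symmetric] s_def[symmetric]
      by (simp add: sum.delta sum.delta')
    also have "\<dots> = (if i = j then 1 else 0)" using s0 by (simp add: power2_eq_square)
    finally show "(H * H) $$ (i,j) = 1\<^sub>m n $$ (i,j)" using ij by simp
  qed (auto simp: H_def)
  moreover have "transpose_mat H = H" by (auto simp: H_def)
  moreover have "col H 0 = v"
  proof
    fix i assume "i < dim_vec v"
    hence i: "i < n" using v by simp
    have "u 0 \<noteq> 0" using s s0 by simp
    hence "2 * u i * u 0 / s = - u i" unfolding s by (simp add: field_simps)
    thus "col H 0 $ i = v $ i" using i n by (auto simp: H_def u_def e_def)
  qed (use v Hc in auto)
  ultimately show ?thesis using that Hc by blast
qed

lemma mult_four_block_diag:
  fixes A1 A2 :: "'a :: comm_ring_1 mat"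
  assumes "A1 \<in> carrier_mat n n" "A2 \<in> carrier_mat n n" "B1 \<in> carrier_mat m m" "B2 \<in> carrier_mat m m"
  shows "four_block_mat A1 (0\<^sub>m n m) (0\<^sub>m m n) B1 * four_block_mat A2 (0\<^sub>m n m) (0\<^sub>m m n) B2
    = four_block_mat (A1 * A2) (0\<^sub>m n m) (0\<^sub>m m n) (B1 * B2)"
  by (subst mult_four_block_mat[where ?nr1.0=n and ?nr2.0=m and ?n1.0=n and ?n2.0=m and ?nc1.0=n and ?nc2.0=m])
     (use assms in auto)

text \<open>Symmetry carries the zeros of the first column over to the first row. This is the
  deflation step: the remaining block is symmetric again and one dimension smaller.\<close>

lemma symmetric_first_col_decomposition:
  fixes A :: "real mat"
  assumes A: "A \<in> carrier_mat (Suc n) (Suc n)" "transpose_mat A = A"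
    and col: "col A 0 = e \<cdot>\<^sub>v unit_vec (Suc n) 0"
  obtains B where "B \<in> carrier_mat n n" "transpose_mat B = B"
    "A = four_block_mat (e \<cdot>\<^sub>m 1\<^sub>m 1) (0\<^sub>m 1 n) (0\<^sub>m n 1) B"
proof -
  define B where "B = mat n n (\<lambda>(i,j). A $$ (Suc i, Suc j))"
  have sym: "A $$ (i,j) = A $$ (j,i)" if "i < Suc n" "j < Suc n" for i j
    using A that by (metis carrier_matD index_transpose_mat(1))
  have c0: "A $$ (i,0) = (if i = 0 then e else 0)" if "i < Suc n" for i
    using arg_cong[OF col, of "\<lambda>v. v $ i"] that A by (auto simp: unit_vec_def)
  have "A = four_block_mat (e \<cdot>\<^sub>m 1\<^sub>m 1) (0\<^sub>m 1 n) (0\<^sub>m n 1) B"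
  proof
    fix i j
    assume "i < dim_row (four_block_mat (e \<cdot>\<^sub>m 1\<^sub>m 1) (0\<^sub>m 1 n) (0\<^sub>m n 1) B)"
      "j < dim_col (four_block_mat (e \<cdot>\<^sub>m 1\<^sub>m 1) (0\<^sub>m 1 n) (0\<^sub>m n 1) B)"
    hence ij: "i < Suc n" "j < Suc n" by (auto simp: B_def)
    show "A $$ (i,j) = four_block_mat (e \<cdot>\<^sub>m 1\<^sub>m 1) (0\<^sub>m 1 n) (0\<^sub>m n 1) B $$ (i,j)"
      using ij c0[of i] c0[of j] sym[of i j] by (auto simp: B_def)
  qed (use A in \<open>auto simp: B_def\<close>)
  moreover have "transpose_mat B = B" using sym by (auto simp: B_def)
  moreover have "B \<in> carrier_mat n n" by (simp add: B_def)
  ultimately show ?thesis using that by blast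
qed

text \<open>Induction on \<open>n\<close>: a reflection \<open>H\<close> with a unit eigenvector as
  its first column turns \<open>A\<close> into the block diagonal \<open>H * A * H\<close>. The
  diagonalization of the smaller block is extended by a 1 and carried back by \<open>H\<close>,
  which is its own inverse.\<close>

lemma real_spectral_theorem:
  fixes A :: "real mat"
  assumes "A \<in> carrier_mat n n" "transpose_mat A = A"
  shows "\<exists>U d. U \<in> carrier_mat n n \<and> transpose_mat U * U = 1\<^sub>m n \<and> A = U * mat_diag n d * transpose_mat U"
  using assms
proof (induction n arbitrary: A)
  case 0
  thus ?case by (intro exI[of _ "1\<^sub>m 0"] exI) auto
next
  case (Suc n)
  note A = Suc.prems
  obtain e v0 where v0: "v0 \<in> carrier_vec (Suc n)" "v0 \<noteq> 0\<^sub>v (Suc n)" "A *\<^sub>v v0 = e \<cdot>\<^sub>v v0"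
    by (rule symmetric_mat_has_eigenvector[OF A]) auto
  define c where "c = sqrt (v0 \<bullet> v0)"
  have c: "c > 0" "c * c = v0 \<bullet> v0"
    using scalar_prod_self_real[of v0] v0 by (auto simp: c_def order_less_le)
  define v where "v = (1/c) \<cdot>\<^sub>v v0"
  have v: "v \<in> carrier_vec (Suc n)" "v \<bullet> v = 1" "A *\<^sub>v v = e \<cdot>\<^sub>v v"
    using v0 c A by (auto simp: v_def mult_mat_vec[of _ "Suc n" "Suc n"] smult_smult_assoc mult.commute)
  obtain H where H: "H \<in> carrier_mat (Suc n) (Suc n)" "transpose_mat H = H" "H * H = 1\<^sub>m (Suc n)" "col H 0 = v"
    using orthogonal_mat_first_col[OF v(1,2)] by auto
  let ?u = "unit_vec (Suc n) 0 :: real vec"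
  have Hu: "H *\<^sub>v ?u = v" using H(1,4) by (auto simp: vec_eq_iff)
  have Hv: "H *\<^sub>v v = ?u"
    using H by (metis Hu assoc_mult_mat_vec one_mult_mat_vec unit_vec_carrier)
  have "transpose_mat (H * A * H) = H * A * H"
    using H A by (simp add: transpose_mult[of _ "Suc n" "Suc n" _ "Suc n"] assoc_mult_mat[of _ "Suc n" "Suc n" _ "Suc n" _ "Suc n"]
        mult_carrier_mat[of _ "Suc n" "Suc n" _ "Suc n"])
  moreover have "col (H * A * H) 0 = e \<cdot>\<^sub>v ?u"
  proof -
    have "col (H * A * H) 0 = (H * A) *\<^sub>v v" using H A by (subst col_mult2) auto
    also have "\<dots> = H *\<^sub>v (e \<cdot>\<^sub>v v)" using H A v by simp
    also have "\<dots> = e \<cdot>\<^sub>v ?u" using H v Hv by (simp add: mult_mat_vec)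
    finally show ?thesis .
  qed
  ultimately obtain B where B: "B \<in> carrier_mat n n" "transpose_mat B = B"
    "H * A * H = four_block_mat (e \<cdot>\<^sub>m 1\<^sub>m 1) (0\<^sub>m 1 n) (0\<^sub>m n 1) B"
    using symmetric_first_col_decomposition[of "H * A * H" n e] H A by auto
  obtain U d where U: "U \<in> carrier_mat n n" "transpose_mat U * U = 1\<^sub>m n" "B = U * mat_diag n d * transpose_mat U"
    using Suc.IH[OF B(1,2)] by auto
  \<comment> \<open>\<open>F\<close> puts two square blocks on the diagonal; it is compatible with
    transposition and multiplication, so the diagonalization of \<open>B\<close> can be lifted block
    by block.\<close>
  define F where "F X Y = four_block_mat X (0\<^sub>m 1 n) (0\<^sub>m n 1) Y" for X Y :: "real mat"
  have F: "F X Y \<in> carrier_mat (Suc n) (Suc n)" "transpose_mat (F X Y) = F (transpose_mat X) (transpose_mat Y)"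
    if "X \<in> carrier_mat 1 1" "Y \<in> carrier_mat n n" for X Y
    using that four_block_carrier_mat[of X 1 1 Y n n] transpose_four_block_mat[of X 1 1 "0\<^sub>m 1 n" n "0\<^sub>m n 1" n Y]
    by (auto simp: F_def)
  have FF: "F X Y * F X' Y' = F (X * X') (Y * Y')"
    if "X \<in> carrier_mat 1 1" "Y \<in> carrier_mat n n" "X' \<in> carrier_mat 1 1" "Y' \<in> carrier_mat n n" for X Y X' Y'
    unfolding F_def using that by (intro mult_four_block_diag) auto
  define V where "V = F (1\<^sub>m 1) U"
  \<comment> \<open>The split-off eigenvalue \<open>e\<close> comes first, so the entries of
    \<open>d\<close> move up by one index.\<close>
  define d' where "d' i = (case i of 0 \<Rightarrow> e | Suc j \<Rightarrow> d j)" for i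
  have V: "V \<in> carrier_mat (Suc n) (Suc n)" "transpose_mat V = F (1\<^sub>m 1) (transpose_mat U)"
    using U F[of "1\<^sub>m 1" U] by (auto simp: V_def)
  have VV: "transpose_mat V * V = 1\<^sub>m (Suc n)"
    using U four_block_one_mat[of 1 n] unfolding V(2) unfolding V_def by (subst FF) (auto simp: F_def)
  have D: "mat_diag (Suc n) d' = F (e \<cdot>\<^sub>m 1\<^sub>m 1) (mat_diag n d)"
    by (rule eq_matI) (auto simp: F_def mat_diag_def d'_def split: nat.splits)
  have HAH: "H * A * H = V * mat_diag (Suc n) d' * transpose_mat V"
  proof -
    have "H * A * H = F (e \<cdot>\<^sub>m 1\<^sub>m 1) B" using B(3) by (simp only: F_def)
    thus ?thesis unfolding D V(2) unfolding V_def using U(1) by (simp add: FF U(3))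
  qed
  \<comment> \<open>Since \<open>H * H\<close> is the identity, conjugating by \<open>H\<close> a
    second time recovers \<open>A\<close>.\<close>
  have "A = (H * H) * A * (H * H)" using A H by simp
  also have "\<dots> = H * (H * A * H) * H"
    using A H(1) by (simp add: assoc_mult_mat[of _ "Suc n" "Suc n" _ "Suc n" _ "Suc n"]
        mult_carrier_mat[of _ "Suc n" "Suc n" _ "Suc n"])
  also have "\<dots> = (H * V) * mat_diag (Suc n) d' * transpose_mat (H * V)"
    unfolding HAH using H(1,2) V(1)
    by (simp add: transpose_mult[of _ "Suc n" "Suc n" _ "Suc n"] assoc_mult_mat[of _ "Suc n" "Suc n" _ "Suc n" _ "Suc n"]
        mult_carrier_mat[of _ "Suc n" "Suc n" _ "Suc n"])
  finally have "A = (H * V) * mat_diag (Suc n) d' * transpose_mat (H * V)" .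
  moreover have "transpose_mat (H * V) * (H * V) = transpose_mat V * ((H * H) * V)"
    using H(1,2) V(1)
    by (simp add: transpose_mult[of _ "Suc n" "Suc n" _ "Suc n"] assoc_mult_mat[of _ "Suc n" "Suc n" _ "Suc n" _ "Suc n"]
        mult_carrier_mat[of _ "Suc n" "Suc n" _ "Suc n"])
  hence "transpose_mat (H * V) * (H * V) = 1\<^sub>m (Suc n)" using H(3) V VV by simp
  ultimately show ?case using H(1) V(1) by (intro exI[of _ "H * V"] exI[of _ d']) auto
qed


section \<open>Quadratic forms in an orthonormal eigenbasis\<close>

lemma mat_diag_quadratic_form:
  fixes w :: "real vec"
  assumes "w \<in> carrier_vec n"
  shows "w \<bullet> (mat_diag n d *\<^sub>v w) = (\<Sum>i<n. d i * (w $ i)\<^sup>2)"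
proof -
  have "(mat_diag n d *\<^sub>v w) $ i = d i * w $ i" if "i < n" for i
    using that assms by (simp add: mat_diag_def scalar_prod_def if_distrib[of "\<lambda>x. x * _"] cong: if_cong)
  thus ?thesis using assms
    by (simp add: scalar_prod_def lessThan_atLeast0 power2_eq_square ac_simps mat_diag_def)
qed

text \<open>Moving \<open>U\<close> across the scalar product leaves a diagonal form in the new
  coordinates. The diagonal \<open>f\<close> stays free because it is used with the eigenvalues,
  with their square roots and with the constant 1.\<close>

lemma conjugated_mat_diag_quadratic_form:
  fixes U :: "real mat"
  assumes U: "U \<in> carrier_mat n m" and v: "v \<in> carrier_vec n"
  shows "v \<bullet> ((U * mat_diag m f * transpose_mat U) *\<^sub>v v) = (\<Sum>i<m. f i * ((transpose_mat U *\<^sub>v v) $ i)\<^sup>2)"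
proof -
  define w where "w = transpose_mat U *\<^sub>v v"
  have w: "w \<in> carrier_vec m" using U v by (simp add: w_def)
  have "v \<bullet> ((U * mat_diag m f * transpose_mat U) *\<^sub>v v) = v \<bullet> (U *\<^sub>v (mat_diag m f *\<^sub>v w))"
    using U v by (simp add: w_def assoc_mult_mat_vec[of _ n m _ n] assoc_mult_mat_vec[of _ n m _ m]
        mult_carrier_mat[of _ n m _ m])
  also have "\<dots> = w \<bullet> (mat_diag m f *\<^sub>v w)"
    using U v w transpose_vec_mult_scalar[of U n m "mat_diag m f *\<^sub>v w" v]
    by (simp add: w_def mult_mat_vec_carrier[of _ m m])
  finally show ?thesis using mat_diag_quadratic_form[OF w] by (simp add: w_def)
qed

text \<open>The spectral theorem in the form in which it is applied: the columns of \<open>U\<close>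
  are orthonormal eigenvectors, and in their coordinates the quadratic form of \<open>A\<close> and
  the squared length can be compared term by term.\<close>

lemma symmetric_mat_eigenbasis:
  fixes A :: "real mat"
  assumes A: "A \<in> carrier_mat n n" "transpose_mat A = A"
  obtains U d where "U \<in> carrier_mat n n" "transpose_mat U * U = 1\<^sub>m n" "U * transpose_mat U = 1\<^sub>m n"
    "A = U * mat_diag n d * transpose_mat U" "\<And>i. i < n \<Longrightarrow> eigenvalue A (d i)"
    "\<And>v. v \<in> carrier_vec n \<Longrightarrow> v \<bullet> (A *\<^sub>v v) = (\<Sum>i<n. d i * ((transpose_mat U *\<^sub>v v) $ i)\<^sup>2)"
    "\<And>v. v \<in> carrier_vec n \<Longrightarrow> v \<bullet> v = (\<Sum>i<n. ((transpose_mat U *\<^sub>v v) $ i)\<^sup>2)"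
proof -
  obtain U d where U: "U \<in> carrier_mat n n" "transpose_mat U * U = 1\<^sub>m n"
    and AU: "A = U * mat_diag n d * transpose_mat U"
    using real_spectral_theorem[OF A] by auto
  have UU: "U * transpose_mat U = 1\<^sub>m n"
    using mat_mult_left_right_inverse[of "transpose_mat U" n U] U by auto
  note form = conjugated_mat_diag_quadratic_form[OF U(1)]
  have "eigenvalue A (d i)" if i: "i < n" for i
  proof -
    \<comment> \<open>Column \<open>i\<close> of this identity is the eigenvector equation for
      \<open>col U i\<close> and \<open>d i\<close>.\<close>
    have "A * U = U * mat_diag n d"
      using U by (simp add: AU right_mult_one_mat[of _ n n] assoc_mult_mat[of _ n n _ n _ n] mult_carrier_mat[of _ n n _ n])
    hence "A *\<^sub>v col U i = col (U * mat_diag n d) i" using A U i by (metis carrier_matD(2) col_mult2)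
    also have "\<dots> = d i \<cdot>\<^sub>v col U i" using U i by (auto simp: mat_diag_mult_right[of _ n n] vec_eq_iff)
    finally have "A *\<^sub>v col U i = d i \<cdot>\<^sub>v col U i" .
    moreover have "col U i \<noteq> 0\<^sub>v n"
    proof
      assume "col U i = 0\<^sub>v n"
      moreover have "(transpose_mat U * U) $$ (i,i) = col U i \<bullet> col U i" using U(1) i by simp
      ultimately show False using U(2) i by simp
    qed
    ultimately show ?thesis using A U i unfolding eigenvalue_def eigenvector_def by (intro exI[of _ "col U i"]) auto
  qed
  \<comment> \<open>The squared length is the form with all diagonal entries equal to 1, because
    \<open>U * transpose_mat U\<close> is the identity.\<close>
  moreover have "v \<bullet> v = (\<Sum>i<n. ((transpose_mat U *\<^sub>v v) $ i)\<^sup>2)" if "v \<in> carrier_vec n" for v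
    using form[OF that, of "\<lambda>_. 1"] UU U that by simp
  ultimately show ?thesis using that[OF U UU AU] form AU by blast
qed

lemma eigenvalueE:
  assumes "eigenvalue A e" "A \<in> carrier_mat n n"
  obtains v where "v \<in> carrier_vec n" "v \<noteq> 0\<^sub>v n" "A *\<^sub>v v = e \<cdot>\<^sub>v v"
  using assms unfolding eigenvalue_def eigenvector_def by auto

lemma pos_semidef_eigenvalue_nonneg:
  assumes "pos_semidef n P" "eigenvalue P e"
  shows "e \<ge> 0"
proof -
  have P: "P \<in> carrier_mat n n" using assms by (simp add: pos_semidef_def)
  obtain v where v: "v \<in> carrier_vec n" "v \<noteq> 0\<^sub>v n" "P *\<^sub>v v = e \<cdot>\<^sub>v v"
    using eigenvalueE[OF assms(2) P] .
  have "0 \<le> e * (v \<bullet> v)" using assms(1) v by (auto simp: pos_semidef_def dest!: bspec[OF _ v(1)])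
  moreover have "v \<bullet> v > 0" using scalar_prod_self_real(1)[of v] scalar_prod_self_real(2)[OF v(1)] v(2) by linarith
  ultimately show ?thesis by (simp add: zero_le_mult_iff)
qed

section \<open>Square roots of positive semidefinite matrices\<close>

text \<open>The root is taken eigenvalue by eigenvalue in an orthonormal eigenbasis, which works
  because no eigenvalue is negative.\<close>

lemma pos_semidef_sqrt_exists:
  assumes "pos_semidef n P"
  obtains S where "pos_semidef n S" "S * S = P"
proof -
  have P: "P \<in> carrier_mat n n" "transpose_mat P = P" using assms by (auto simp: pos_semidef_def)
  obtain U d where U: "U \<in> carrier_mat n n" "transpose_mat U * U = 1\<^sub>m n" and PU: "P = U * mat_diag n d * transpose_mat U"
    and d: "\<And>i. i < n \<Longrightarrow> eigenvalue P (d i)"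
    by (rule symmetric_mat_eigenbasis[OF P], rule that) (assumption | simp)+
  define s where "s i = sqrt (d i)" for i
  define S where "S = U * mat_diag n s * transpose_mat U"
  have s: "s i \<ge> 0" "s i * s i = d i" if "i < n" for i
    using pos_semidef_eigenvalue_nonneg[OF assms d[OF that]] by (auto simp: s_def)
  have S: "S \<in> carrier_mat n n" using U by (simp add: S_def mult_carrier_mat[of _ n n _ n])
  have "transpose_mat (mat_diag n s) = mat_diag n s" by (auto simp: mat_diag_def)
  hence "transpose_mat S = S" using U
    by (simp add: S_def transpose_mult[of _ n n _ n] assoc_mult_mat[of _ n n _ n _ n] mult_carrier_mat[of _ n n _ n])
  moreover have "v \<bullet> (S *\<^sub>v v) \<ge> 0" if "v \<in> carrier_vec n" for v
    unfolding S_def conjugated_mat_diag_quadratic_form[OF U(1) that] using s(1) by (auto intro!: sum_nonneg)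
  moreover have "S * S = P"
  proof -
    have "S * S = U * (mat_diag n s * (transpose_mat U * U) * mat_diag n s) * transpose_mat U"
      using U(1) by (simp add: S_def assoc_mult_mat[of _ n n _ n _ n] mult_carrier_mat[of _ n n _ n])
    also have "mat_diag n s * (transpose_mat U * U) * mat_diag n s = mat_diag n d"
      unfolding U(2) using s(2) by (simp add: right_mult_one_mat[of _ n n]) (auto simp: mat_diag_def)
    finally show ?thesis by (simp add: PU)
  qed
  ultimately show ?thesis using that[of S] S by (auto simp: pos_semidef_def)
qed

text \<open>The difference \<open>E\<close> of two square roots satisfies \<open>S E + E T = 0\<close>, so all eigenvalues
  of the symmetric matrix \<open>E\<close> vanish.\<close>

lemma pos_semidef_sqrt_unique:
  assumes S: "pos_semidef n S" and T: "pos_semidef n T" and eq: "S * S = T * T"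
  shows "S = T"
proof -
  have Sc: "S \<in> carrier_mat n n" "transpose_mat S = S" and Tc: "T \<in> carrier_mat n n" "transpose_mat T = T"
    using S T by (auto simp: pos_semidef_def)
  define E where "E = S - T"
  have E: "E \<in> carrier_mat n n" "transpose_mat E = E"
    using Sc Tc by (auto simp: E_def transpose_minus[of _ n n])
  obtain U d where U: "U \<in> carrier_mat n n" and EU: "E = U * mat_diag n d * transpose_mat U"
    and d: "\<And>i. i < n \<Longrightarrow> eigenvalue E (d i)"
    by (rule symmetric_mat_eigenbasis[OF E], rule that) (assumption | simp)+
  have "d i = 0" if i: "i < n" for i
  proof (rule ccontr)
    assume nz: "d i \<noteq> 0"
    obtain v where v: "v \<in> carrier_vec n" "v \<noteq> 0\<^sub>v n" "E *\<^sub>v v = d i \<cdot>\<^sub>v v"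
      using eigenvalueE[OF d[OF i] E(1)] .
    have ST: "S *\<^sub>v v = T *\<^sub>v v + d i \<cdot>\<^sub>v v"
      using v(1,3) Sc Tc by (auto simp: E_def minus_mult_distrib_mat_vec[of _ n n] vec_eq_iff)
    have Sv: "S *\<^sub>v v \<in> carrier_vec n" and Tv: "T *\<^sub>v v \<in> carrier_vec n" using Sc Tc v by auto
    have "(S *\<^sub>v v) \<bullet> (S *\<^sub>v v) = (T *\<^sub>v v) \<bullet> (T *\<^sub>v v)"
    proof -
      have "(S *\<^sub>v v) \<bullet> (S *\<^sub>v v) = v \<bullet> (S * S *\<^sub>v v)"
        using transpose_vec_mult_scalar[of S n n "S *\<^sub>v v" v] Sc v Sv by simp
      moreover have "(T *\<^sub>v v) \<bullet> (T *\<^sub>v v) = v \<bullet> (T * T *\<^sub>v v)"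
        using transpose_vec_mult_scalar[of T n n "T *\<^sub>v v" v] Tc v Tv by simp
      ultimately show ?thesis using eq by simp
    qed
    \<comment> \<open>On \<open>v\<close> the matrices \<open>S\<close> and \<open>T\<close> differ
      by the multiple \<open>d i\<close> of \<open>v\<close>, so the difference of the squared
      lengths factors as for numbers.\<close>
    moreover have "(S *\<^sub>v v) \<bullet> (S *\<^sub>v v) - (T *\<^sub>v v) \<bullet> (T *\<^sub>v v) = d i * (v \<bullet> (S *\<^sub>v v) + v \<bullet> (T *\<^sub>v v))"
      unfolding ST using v Tv comm_scalar_prod[OF v(1) Tv]
      by (simp add: scalar_prod_add_distrib[of _ n] add_scalar_prod_distrib[of _ n] algebra_simps)
    \<comment> \<open>Two nonnegative numbers with sum 0 both vanish, hence so does their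
      difference, which is \<open>d i\<close> times the squared length of \<open>v\<close>.\<close>
    ultimately have "v \<bullet> (S *\<^sub>v v) + v \<bullet> (T *\<^sub>v v) = 0" using nz by simp
    moreover have "v \<bullet> (S *\<^sub>v v) \<ge> 0" "v \<bullet> (T *\<^sub>v v) \<ge> 0" using S T v by (auto simp: pos_semidef_def)
    moreover have "v \<bullet> (S *\<^sub>v v) = v \<bullet> (T *\<^sub>v v) + d i * (v \<bullet> v)"
      unfolding ST using v Tv by (simp add: scalar_prod_add_distrib[of _ n])
    ultimately have "d i * (v \<bullet> v) = 0" by linarith
    thus False using nz v scalar_prod_self_real(2)[OF v(1)] by simp
  qed
  hence "mat_diag n d = 0\<^sub>m n n" by (auto simp: mat_diag_def)
  hence "E = 0\<^sub>m n n" using U by (simp add: EU)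
  hence "(S - T) $$ (i,j) = 0" if "i < n" "j < n" for i j using that by (simp add: E_def)
  thus ?thesis using Sc(1) Tc(1) by (intro eq_matI) auto
qed

text \<open>Existence and uniqueness justify the definite description in
  \<open>psd_sqrt\<close>.\<close>

lemma psd_sqrt:
  assumes "pos_semidef n P"
  shows "pos_semidef n (psd_sqrt P)" "psd_sqrt P * psd_sqrt P = P"
proof -
  have dim: "dim_row P = n" using assms by (meson carrier_matD(1) pos_semidef_def)
  obtain S where S: "pos_semidef n S" "S * S = P" using pos_semidef_sqrt_exists[OF assms] .
  have "\<exists>!S. pos_semidef (dim_row P) S \<and> S * S = P"
    unfolding dim using S pos_semidef_sqrt_unique by (intro ex1I[of _ S]) auto
  from theI'[OF this] show "pos_semidef n (psd_sqrt P)" "psd_sqrt P * psd_sqrt P = P"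
    unfolding psd_sqrt_def dim by blast+
qed

section \<open>The matrix 2-norm and the Loewner order\<close>

text \<open>The norm bound says that no eigenvalue of \<open>transpose_mat X * X\<close> exceeds 1.
  In an orthonormal eigenbasis this bounds the form term by term; conversely, the form is tested on
  an eigenvector. The assumption \<open>n > 0\<close> makes the set under \<open>Max\<close>
  nonempty.\<close>

lemma matrix_norm2_le_1_iff:
  assumes X: "X \<in> carrier_mat k n" and n: "n > 0"
  shows "matrix_norm2 X \<le> 1 \<longleftrightarrow> (\<forall>v\<in>carrier_vec n. v \<bullet> (transpose_mat X * X *\<^sub>v v) \<le> v \<bullet> v)"
proof -
  define Q where "Q = transpose_mat X * X"
  define E where "E = {s. s \<ge> 0 \<and> eigenvalue Q (s\<^sup>2)}"
  have Q: "Q \<in> carrier_mat n n" "transpose_mat Q = Q"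
    using X by (auto simp: Q_def transpose_mult[of _ n k _ n])
  have "v \<bullet> (Q *\<^sub>v v) = (X *\<^sub>v v) \<bullet> (X *\<^sub>v v)" if "v \<in> carrier_vec n" for v
    using X that transpose_vec_mult_scalar[of "transpose_mat X" n k "X *\<^sub>v v" v]
    by (simp add: Q_def assoc_mult_mat_vec[of _ n k _ n])
  hence psd: "pos_semidef n Q" using Q by (simp add: pos_semidef_def scalar_prod_self_real)
  obtain U d where U: "U \<in> carrier_mat n n"
    and d: "\<And>i. i < n \<Longrightarrow> eigenvalue Q (d i)"
    and form: "\<And>v. v \<in> carrier_vec n \<Longrightarrow> v \<bullet> (Q *\<^sub>v v) = (\<Sum>i<n. d i * ((transpose_mat U *\<^sub>v v) $ i)\<^sup>2)"
      "\<And>v. v \<in> carrier_vec n \<Longrightarrow> v \<bullet> v = (\<Sum>i<n. ((transpose_mat U *\<^sub>v v) $ i)\<^sup>2)"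
    by (rule symmetric_mat_eigenbasis[OF Q], rule that) (assumption | simp)+
  have sqrt_d: "sqrt (d i) \<in> E" "d i = (sqrt (d i))\<^sup>2" if "i < n" for i
    using d[OF that] pos_semidef_eigenvalue_nonneg[OF psd d[OF that]] by (auto simp: E_def)
  \<comment> \<open>Finiteness of the set under \<open>Max\<close>: its elements are square roots of
    the roots of a nonzero polynomial.\<close>
  have "char_poly Q \<noteq> 0" using degree_monic_char_poly[OF Q(1)] n by auto
  hence "finite (sqrt ` {x. poly (char_poly Q) x = 0})" by (simp add: poly_roots_finite)
  moreover have "E \<subseteq> sqrt ` {x. poly (char_poly Q) x = 0}"
    using eigenvalue_root_char_poly[OF Q(1)] by (auto simp: E_def image_iff intro!: exI[of _ "_\<^sup>2"])
  ultimately have "finite E" by (rule finite_subset[rotated])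
  moreover have "E \<noteq> {}" using sqrt_d(1)[OF n] by auto
  ultimately have "matrix_norm2 X \<le> 1 \<longleftrightarrow> (\<forall>s\<in>E. s \<le> 1)"
    by (simp add: matrix_norm2_def Q_def[symmetric] E_def)
  also have "\<dots> \<longleftrightarrow> (\<forall>v\<in>carrier_vec n. v \<bullet> (Q *\<^sub>v v) \<le> v \<bullet> v)"
  proof (intro iffI ballI)
    fix v :: "real vec" assume le: "\<forall>s\<in>E. s \<le> 1" and v: "v \<in> carrier_vec n"
    have "d i \<le> 1" if "i < n" for i
      using le sqrt_d[OF that] by (metis E_def abs_square_le_1 abs_of_nonneg mem_Collect_eq)
    thus "v \<bullet> (Q *\<^sub>v v) \<le> v \<bullet> v" unfolding form[OF v]
      using mult_right_mono[of "d _" 1 "_\<^sup>2"] by (intro sum_mono) auto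
  next
    fix s assume le: "\<forall>v\<in>carrier_vec n. v \<bullet> (Q *\<^sub>v v) \<le> v \<bullet> v" and s: "s \<in> E"
    obtain v where v: "v \<in> carrier_vec n" "v \<noteq> 0\<^sub>v n" "Q *\<^sub>v v = s\<^sup>2 \<cdot>\<^sub>v v"
      using eigenvalueE[of Q "s\<^sup>2" n] s Q by (auto simp: E_def)
    have "s\<^sup>2 * (v \<bullet> v) \<le> 1 * (v \<bullet> v)" using bspec[OF le v(1)] v by simp
    moreover have "v \<bullet> v > 0" using scalar_prod_self_real(1)[of v] scalar_prod_self_real(2)[OF v(1)] v(2) by linarith
    ultimately have "s\<^sup>2 \<le> 1" using mult_le_cancel_right_pos by blast
    thus "s \<le> 1" by (simp add: abs_square_le_1)
  qed
  finally show ?thesis unfolding Q_def .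
qed

text \<open>Positive definiteness makes the square root invertible, so \<open>mat_inverse\<close>
  returns a matrix and \<open>inv_sqrt\<close> is the true inverse. Symmetry passes from the root to
  its inverse.\<close>

lemma inv_sqrt:
  assumes \<Sigma>: "pos_def n \<Sigma>"
  shows "inv_sqrt \<Sigma> \<in> carrier_mat n n" "transpose_mat (inv_sqrt \<Sigma>) = inv_sqrt \<Sigma>"
    "psd_sqrt \<Sigma> * inv_sqrt \<Sigma> = 1\<^sub>m n" "inv_sqrt \<Sigma> * psd_sqrt \<Sigma> = 1\<^sub>m n"
    "inv_sqrt \<Sigma> * \<Sigma> * inv_sqrt \<Sigma> = 1\<^sub>m n"
proof -
  define S where "S = psd_sqrt \<Sigma>"
  define T where "T = inv_sqrt \<Sigma>"
  have "v \<bullet> (\<Sigma> *\<^sub>v v) \<ge> 0" if "v \<in> carrier_vec n" for v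
    using \<Sigma> that by (cases "v = 0\<^sub>v n") (auto simp: pos_def_def order_less_imp_le)
  hence "pos_semidef n \<Sigma>" using \<Sigma> by (auto simp: pos_def_def pos_semidef_def)
  hence S: "S \<in> carrier_mat n n" "transpose_mat S = S" "S * S = \<Sigma>"
    using psd_sqrt[of n \<Sigma>] by (auto simp: S_def pos_semidef_def)
  \<comment> \<open>A kernel vector of the root would be a kernel vector of \<open>\<Sigma>\<close>,
    and the form would vanish on it.\<close>
  have "det S \<noteq> 0"
  proof
    assume "det S = 0"
    then obtain v where v: "v \<in> carrier_vec n" "v \<noteq> 0\<^sub>v n" "S *\<^sub>v v = 0\<^sub>v n"
      using det_0_iff_vec_prod_zero_field[OF S(1)] by auto
    have "\<Sigma> *\<^sub>v v = 0\<^sub>v n" unfolding S(3)[symmetric] using S(1) v by auto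
    thus False using \<Sigma> v by (auto simp: pos_def_def)
  qed
  hence "S \<in> Units (ring_mat TYPE(real) n ())" using det_non_zero_imp_unit[OF S(1)] by simp
  then obtain T' where "mat_inverse S = Some T'" using mat_inverse(1)[OF S(1), of "()"] by (cases "mat_inverse S") auto
  hence T: "S * T = 1\<^sub>m n" "T * S = 1\<^sub>m n" "T \<in> carrier_mat n n"
    using mat_inverse(2)[OF S(1), of T'] by (auto simp: T_def inv_sqrt_def S_def)
  \<comment> \<open>The transpose of \<open>T\<close> is a left inverse of \<open>S\<close> while
    \<open>T\<close> is a right inverse, so the two coincide.\<close>
  have "transpose_mat T * S = 1\<^sub>m n" using arg_cong[OF T(1), of transpose_mat] S(1,2) T(3)
    by (simp add: transpose_mult[of _ n n _ n])
  hence "transpose_mat T * (S * T) = T"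
    using assoc_mult_mat[of "transpose_mat T" n n S n T n] S(1) T(3) by simp
  hence sym: "transpose_mat T = T" using T(3) by (simp add: T(1) right_mult_one_mat[of _ n n])
  have "T * \<Sigma> * T = (T * S) * (S * T)" unfolding S(3)[symmetric]
    using S(1) T(3) by (simp add: assoc_mult_mat[of _ n n _ n _ n] mult_carrier_mat[of _ n n _ n])
  hence "T * \<Sigma> * T = 1\<^sub>m n" using T by simp
  with T sym show "inv_sqrt \<Sigma> \<in> carrier_mat n n" "transpose_mat (inv_sqrt \<Sigma>) = inv_sqrt \<Sigma>"
    "psd_sqrt \<Sigma> * inv_sqrt \<Sigma> = 1\<^sub>m n" "inv_sqrt \<Sigma> * psd_sqrt \<Sigma> = 1\<^sub>m n"
    "inv_sqrt \<Sigma> * \<Sigma> * inv_sqrt \<Sigma> = 1\<^sub>m n"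
    by (auto simp: T_def S_def)
qed

text \<open>The substitution \<open>v = inv_sqrt \<Sigma> *\<^sub>v w\<close> turns the Loewner inequality into the bound on the norm.\<close>

lemma loewner_le_iff_matrix_norm2:
  assumes S: "pos_semidef m S" and F: "F \<in> carrier_mat n m" and \<Sigma>: "pos_def n \<Sigma>" and n: "n > 0"
  shows "loewner_le n (F * S * transpose_mat F) \<Sigma> \<longleftrightarrow>
    matrix_norm2 (psd_sqrt S * transpose_mat F * inv_sqrt \<Sigma>) \<le> 1"
proof -
  define R where "R = psd_sqrt S"
  define T where "T = inv_sqrt \<Sigma>"
  define C where "C = F * S * transpose_mat F"
  define X where "X = R * transpose_mat F * T"
  have R: "R \<in> carrier_mat m m" "transpose_mat R = R" "R * R = S"
    using psd_sqrt[OF S] by (auto simp: R_def pos_semidef_def)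
  have T: "T \<in> carrier_mat n n" "transpose_mat T = T" "T * \<Sigma> * T = 1\<^sub>m n"
    and inv: "T * psd_sqrt \<Sigma> = 1\<^sub>m n"
    using inv_sqrt[OF \<Sigma>] by (auto simp: T_def)
  have Sc: "S \<in> carrier_mat m m" "transpose_mat S = S" using S by (auto simp: pos_semidef_def)
  have sc: "\<Sigma> \<in> carrier_mat n n" "transpose_mat \<Sigma> = \<Sigma>" using \<Sigma> by (auto simp: pos_def_def)
  have pS: "psd_sqrt \<Sigma> \<in> carrier_mat n n"
    using inv_sqrt(3,4)[OF \<Sigma>] T(1) by (metis T_def carrier_matI index_mult_mat(2,3) index_one_mat(2,3))
  have X: "X \<in> carrier_mat m n" using R T F by (simp add: X_def)
  have C: "C \<in> carrier_mat n n" "transpose_mat C = C"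
    using F Sc by (auto simp: C_def transpose_mult[of _ n m _ n] transpose_mult[of _ m m _ n]
        mult_carrier_mat[of _ m m _ n] assoc_mult_mat[of _ n m _ m _ n])
  note assoc = assoc_mult_mat[of _ n n _ n _ n] assoc_mult_mat[of _ n n _ m _ m] assoc_mult_mat[of _ n n _ m _ n]
    assoc_mult_mat[of _ n m _ m _ n] assoc_mult_mat[of _ n m _ n _ n] assoc_mult_mat[of _ n m _ m _ m]
    assoc_mult_mat[of _ m m _ m _ n] assoc_mult_mat[of _ m m _ n _ n]
    mult_carrier_mat[of _ n n _ m] mult_carrier_mat[of _ n m _ m] mult_carrier_mat[of _ n m _ n]
    mult_carrier_mat[of _ m m _ n] mult_carrier_mat[of _ m n _ n]
  \<comment> \<open>Transposing \<open>X\<close> reverses the factors and leaves the symmetric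
    \<open>R\<close> and \<open>T\<close> alone; the two copies of \<open>R\<close> then meet and
    multiply to \<open>S\<close>.\<close>
  have "transpose_mat X * X = T * F * R * (R * transpose_mat F * T)"
    using R(1,2) T(1,2) F unfolding X_def
    by (simp add: transpose_mult[of _ m n _ n] transpose_mult[of _ m m _ n]
        assoc_mult_mat[of _ n n _ m _ m] mult_carrier_mat[of _ n m _ m])
  also have "\<dots> = T * F * (R * R) * transpose_mat F * T"
    using R(1) T(1) F
    by (simp add: assoc)
  also have "\<dots> = T * C * T"
    unfolding R(3) C_def using Sc T(1) F
    by (simp add: assoc)
  finally have XX: "transpose_mat X * X = T * C * T" .
  \<comment> \<open>The symmetric factor \<open>T\<close> moves across the scalar product. With
    \<open>\<Sigma>\<close> for \<open>P\<close> the matrix on the right is the identity, which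
    yields the comparison with the squared length.\<close>
  have conj: "(T *\<^sub>v w) \<bullet> (P *\<^sub>v (T *\<^sub>v w)) = w \<bullet> (T * P * T *\<^sub>v w)"
    if "w \<in> carrier_vec n" "P \<in> carrier_mat n n" for w P
    using transpose_vec_mult_scalar[of T n n "P *\<^sub>v (T *\<^sub>v w)" w] T that
    by (simp add: assoc_mult_mat_vec[of _ n n _ n] mult_mat_vec_carrier[of _ n n])
  have diff: "v \<bullet> ((\<Sigma> - C) *\<^sub>v v) = v \<bullet> (\<Sigma> *\<^sub>v v) - v \<bullet> (C *\<^sub>v v)" if "v \<in> carrier_vec n" for v
    using that C sc by (simp add: minus_mult_distrib_mat_vec[of _ n n] scalar_prod_minus_distrib[of _ n])
  have "loewner_le n C \<Sigma> \<longleftrightarrow> (\<forall>v\<in>carrier_vec n. v \<bullet> (C *\<^sub>v v) \<le> v \<bullet> (\<Sigma> *\<^sub>v v))"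
    using C sc diff by (auto simp: loewner_le_def pos_semidef_def transpose_minus[of _ n n])
  also have "\<dots> \<longleftrightarrow> (\<forall>w\<in>carrier_vec n. (T *\<^sub>v w) \<bullet> (C *\<^sub>v (T *\<^sub>v w)) \<le> (T *\<^sub>v w) \<bullet> (\<Sigma> *\<^sub>v (T *\<^sub>v w)))"
  proof (intro iffI ballI)
    fix v :: "real vec"
    assume le: "\<forall>w\<in>carrier_vec n. (T *\<^sub>v w) \<bullet> (C *\<^sub>v (T *\<^sub>v w)) \<le> (T *\<^sub>v w) \<bullet> (\<Sigma> *\<^sub>v (T *\<^sub>v w))"
      and v: "v \<in> carrier_vec n"
    \<comment> \<open>Every vector lies in the range of \<open>T\<close>, so the bound on that range
      covers all \<open>v\<close>.\<close>
    have "T *\<^sub>v (psd_sqrt \<Sigma> *\<^sub>v v) = v" using inv pS T v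
      by (simp add: assoc_mult_mat_vec[of _ n n _ n, symmetric])
    thus "v \<bullet> (C *\<^sub>v v) \<le> v \<bullet> (\<Sigma> *\<^sub>v v)" using bspec[OF le, of "psd_sqrt \<Sigma> *\<^sub>v v"] pS v by simp
  qed (use T in auto)
  also have "\<dots> \<longleftrightarrow> (\<forall>w\<in>carrier_vec n. w \<bullet> (transpose_mat X * X *\<^sub>v w) \<le> w \<bullet> w)"
    using conj[of _ C] conj[of _ \<Sigma>] C sc T(3) XX by auto
  also have "\<dots> \<longleftrightarrow> matrix_norm2 X \<le> 1" using matrix_norm2_le_1_iff[OF X n] by simp
  finally show ?thesis unfolding C_def X_def R_def T_def .
qed

section \<open>Congruence, sums and zero blocks of semidefinite matrices\<close>

text \<open>Pulls a common outer factor out of the covariance terms of the initial state and of the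
  noise, so that the terms can be added inside.\<close>

lemma mult_congruence:
  fixes S :: "'a :: comm_semiring_1 mat"
  assumes G: "G \<in> carrier_mat k m" and A: "A \<in> carrier_mat m n" and S: "S \<in> carrier_mat n n"
  shows "G * A * S * transpose_mat (G * A) = G * (A * S * transpose_mat A) * transpose_mat G"
proof -
  have At: "transpose_mat A \<in> carrier_mat n m" and Gt: "transpose_mat G \<in> carrier_mat m k"
    and AS: "A * S \<in> carrier_mat m n" and ASA: "A * S * transpose_mat A \<in> carrier_mat m m"
    using G A S by auto
  show ?thesis
    unfolding transpose_mult[OF G A] assoc_mult_mat[OF G A S]
      assoc_mult_mat[OF G AS mult_carrier_mat[OF At Gt]] assoc_mult_mat[OF AS At Gt, symmetric]
      assoc_mult_mat[OF G ASA Gt] ..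
qed

text \<open>The form at \<open>v\<close> is the form of \<open>S\<close> at the image of
  \<open>v\<close> under the transpose of \<open>F\<close>.\<close>

lemma pos_semidef_congruence:
  assumes S: "pos_semidef n S" and F: "F \<in> carrier_mat m n"
  shows "pos_semidef m (F * S * transpose_mat F)"
  unfolding pos_semidef_def
proof (intro conjI ballI)
  have Sc: "S \<in> carrier_mat n n" "transpose_mat S = S" using S by (auto simp: pos_semidef_def)
  show "F * S * transpose_mat F \<in> carrier_mat m m"
    using F Sc by (intro mult_carrier_mat[of _ m n _ m] mult_carrier_mat[of _ m n _ n]) auto
  show "transpose_mat (F * S * transpose_mat F) = F * S * transpose_mat F"
    using F Sc by (simp add: transpose_mult[of _ m n _ m] transpose_mult[of _ n n _ m]
        mult_carrier_mat[of _ n n _ m] assoc_mult_mat[of _ m n _ n _ m])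
  fix v :: "real vec" assume v: "v \<in> carrier_vec m"
  define w where "w = transpose_mat F *\<^sub>v v"
  have w: "w \<in> carrier_vec n" using F v by (simp add: w_def)
  have "v \<bullet> ((F * S * transpose_mat F) *\<^sub>v v) = v \<bullet> (F *\<^sub>v (S *\<^sub>v w))"
    using F Sc v by (simp add: w_def assoc_mult_mat_vec[of _ m n _ m] assoc_mult_mat_vec[of _ m n _ n]
        mult_carrier_mat[of _ m n _ n])
  also have "\<dots> = w \<bullet> (S *\<^sub>v w)"
    unfolding w_def using F Sc v w transpose_vec_mult_scalar[of F m n "S *\<^sub>v w" v]
    by (simp add: w_def mult_mat_vec_carrier[of _ n n])
  finally show "v \<bullet> ((F * S * transpose_mat F) *\<^sub>v v) \<ge> 0" using S w by (simp add: pos_semidef_def)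
qed

lemma pos_semidef_one: "pos_semidef n (1\<^sub>m n)"
  by (auto simp: pos_semidef_def scalar_prod_self_real)

lemma pos_semidef_add:
  assumes "pos_semidef n S" "pos_semidef n T"
  shows "pos_semidef n (S + T)"
  using assms
  by (auto simp: pos_semidef_def transpose_add[of _ n n] add_mult_distrib_mat_vec[of _ n n] scalar_prod_add_distrib[of _ n])

text \<open>The form sees only the last \<open>n\<close> coordinates of a vector. The augmented
  initial state has a covariance of this shape, as its constant block has no variance.\<close>

lemma pos_semidef_zero_block:
  assumes S: "pos_semidef n S"
  shows "pos_semidef (m + n) (four_block_mat (0\<^sub>m m m) (0\<^sub>m m n) (0\<^sub>m n m) S)"
proof -
  let ?B = "four_block_mat (0\<^sub>m m m) (0\<^sub>m m n) (0\<^sub>m n m) S"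
  have Sc: "S \<in> carrier_mat n n" "transpose_mat S = S" using S by (auto simp: pos_semidef_def)
  have "v \<bullet> (?B *\<^sub>v v) \<ge> 0" if v: "v \<in> carrier_vec (m + n)" for v
  proof -
    define a b where "a = vec_first v m" and "b = vec_last v n"
    have ab: "a \<in> carrier_vec m" "b \<in> carrier_vec n" and vab: "v = a @\<^sub>v b"
      using vec_first_last_append[OF v] by (auto simp: a_def b_def)
    have "?B *\<^sub>v v = 0\<^sub>v m @\<^sub>v (S *\<^sub>v b)"
      unfolding vab using ab Sc(1)
      by (subst four_block_mat_mult_vec[where ?nr1.0 = m and ?nr2.0 = n and ?nc1.0 = m and ?nc2.0 = n])
        (auto intro!: arg_cong2[where f = append_vec])
    hence "v \<bullet> (?B *\<^sub>v v) = b \<bullet> (S *\<^sub>v b)"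
      using ab Sc(1) unfolding vab by (simp add: scalar_prod_append[of _ m _ n])
    thus ?thesis using S ab by (simp add: pos_semidef_def)
  qed
  moreover have "transpose_mat ?B = ?B"
    using Sc by (subst transpose_four_block_mat[of _ m m _ n _ n]) auto
  ultimately show ?thesis using Sc by (auto simp: pos_semidef_def)
qed

section \<open>Moments of random vectors\<close>

text \<open>Finite second moments make the moment identities statements about integrals that exist;
  the Bochner integral of a non-integrable function is 0 by convention.\<close>

definition square_integrable_vec :: "'a measure \<Rightarrow> nat \<Rightarrow> ('a \<Rightarrow> real vec) \<Rightarrow> bool" where
  "square_integrable_vec M n X \<longleftrightarrow> random_vec M n X \<and> (\<forall>i<n. integrable M (\<lambda>\<omega>. (X \<omega> $ i)\<^sup>2))"

text \<open>A normal density has finite moments; a point mass is almost everywhere equal to a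
  constant, which is integrable on a probability space.\<close>

lemma (in prob_space) gaussian_var_square_integrable:
  assumes "gaussian_var M Y"
  shows "integrable M (\<lambda>\<omega>. (Y \<omega>)\<^sup>2)"
  using assms unfolding gaussian_var_def
proof (elim disjE exE conjE)
  fix m s :: real
  assume s: "s > 0" and Y: "distributed M lborel Y (normal_density m s)"
  have "integrable M (\<lambda>\<omega>. (Y \<omega> - m) ^ k)" for k
    using distributed_integrable[OF Y, of "\<lambda>x. (x - m) ^ k"] integrable_normal_moment[OF s] by simp
  \<comment> \<open>The square is expanded around \<open>m\<close>, since the moments at hand are
    the central ones.\<close>
  from this[of 2] this[of 1] have "integrable M (\<lambda>\<omega>. (Y \<omega> - m)\<^sup>2 + 2 * m * (Y \<omega> - m) + m\<^sup>2)" by simp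
  thus ?thesis by (rule Bochner_Integration.integrable_cong[THEN iffD1, rotated 2])
    (auto simp: power2_eq_square algebra_simps)
next
  fix m :: real
  assume Y: "Y \<in> borel_measurable M" and m: "AE \<omega> in M. Y \<omega> = m"
  have "integrable M (\<lambda>\<omega>. m\<^sup>2)" by simp
  moreover have "AE \<omega> in M. m\<^sup>2 = (Y \<omega>)\<^sup>2" using m by eventually_elim simp
  ultimately show ?thesis using Y by (subst integrable_cong_AE[where g = "\<lambda>_. m\<^sup>2"]) auto
qed

lemma (in prob_space) gaussian_vec_square_integrable:
  assumes "gaussian_vec M n X"
  shows "square_integrable_vec M n X"
  unfolding square_integrable_vec_def
proof (intro conjI allI impI)
  show X: "random_vec M n X" using assms by (simp add: gaussian_vec_def)
  fix i assume i: "i < n"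
  \<comment> \<open>A component is the linear combination with a unit vector, hence Gaussian by
    definition.\<close>
  have "integrable M (\<lambda>\<omega>. (unit_vec n i \<bullet> X \<omega>)\<^sup>2)"
    using assms by (intro gaussian_var_square_integrable) (simp add: gaussian_vec_def)
  thus "integrable M (\<lambda>\<omega>. (X \<omega> $ i)\<^sup>2)"
    using X i by (subst Bochner_Integration.integrable_cong[OF refl, where g = "\<lambda>\<omega>. (unit_vec n i \<bullet> X \<omega>)\<^sup>2"])
      (auto simp: random_vec_def)
qed

text \<open>The product is dominated by the sum of the two squares.\<close>

lemma square_integrable_vec_product:
  assumes "square_integrable_vec M n X" "square_integrable_vec M m Y" "i < n" "j < m"
  shows "integrable M (\<lambda>\<omega>. X \<omega> $ i * Y \<omega> $ j)"
proof (rule Bochner_Integration.integrable_bound)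
  show "integrable M (\<lambda>\<omega>. (X \<omega> $ i)\<^sup>2 + (Y \<omega> $ j)\<^sup>2)"
    using assms by (auto simp: square_integrable_vec_def)
  show "(\<lambda>\<omega>. X \<omega> $ i * Y \<omega> $ j) \<in> borel_measurable M"
    using assms by (intro borel_measurable_times) (auto simp: square_integrable_vec_def random_vec_def)
  have "\<bar>x * y\<bar> \<le> x\<^sup>2 + y\<^sup>2" for x y :: real
  proof -
    have "2 * (\<bar>x\<bar> * \<bar>y\<bar>) \<le> x\<^sup>2 + y\<^sup>2" using sum_squares_bound[of "\<bar>x\<bar>" "\<bar>y\<bar>"] by simp
    moreover have "0 \<le> x\<^sup>2 + y\<^sup>2" by simp
    ultimately show ?thesis unfolding abs_mult by linarith
  qed
  thus "AE \<omega> in M. norm (X \<omega> $ i * Y \<omega> $ j) \<le> norm ((X \<omega> $ i)\<^sup>2 + (Y \<omega> $ j)\<^sup>2)" by simp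
qed

lemma (in prob_space) square_integrable_vec_integrable:
  assumes "square_integrable_vec M n X" "i < n"
  shows "integrable M (\<lambda>\<omega>. X \<omega> $ i)"
proof -
  \<comment> \<open>The constant 1 is square integrable on a probability space, and a component is
    its own product with 1.\<close>
  have "square_integrable_vec M 1 (\<lambda>_. vec 1 (\<lambda>_. 1))" by (simp add: square_integrable_vec_def random_vec_def)
  from square_integrable_vec_product[OF assms(1) this assms(2), of 0] show ?thesis by simp
qed

section \<open>Moments of linear images of random vectors\<close>

lemma mult_mat_vec_index_sum:
  assumes "P \<in> carrier_mat k n" "x \<in> carrier_vec n" "i < k"
  shows "(P *\<^sub>v x) $ i = (\<Sum>a<n. P $$ (i,a) * x $ a)"
  using assms by (simp add: scalar_prod_def lessThan_atLeast0)

text \<open>Both factors expand into finite sums, after which linearity of the integral suffices.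
  Integrability is recorded as well because such terms are added later.\<close>

lemma integral_mult_mat_vec_product:
  assumes X: "square_integrable_vec M n X" and Y: "square_integrable_vec M m Y"
    and P: "P \<in> carrier_mat k n" and Q: "Q \<in> carrier_mat l m" and ij: "i < k" "j < l"
  shows "integrable M (\<lambda>\<omega>. (P *\<^sub>v X \<omega>) $ i * (Q *\<^sub>v Y \<omega>) $ j)"
    and "integral\<^sup>L M (\<lambda>\<omega>. (P *\<^sub>v X \<omega>) $ i * (Q *\<^sub>v Y \<omega>) $ j) =
      (P * expectation_mat M n m (\<lambda>\<omega>. outer_prod (X \<omega>) (Y \<omega>)) * transpose_mat Q) $$ (i,j)"
proof -
  define f where "f \<omega> = (\<Sum>a<n. \<Sum>b<m. P $$ (i,a) * Q $$ (j,b) * (X \<omega> $ a * Y \<omega> $ b))" for \<omega>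
  have dim: "X \<omega> \<in> carrier_vec n" "Y \<omega> \<in> carrier_vec m" if "\<omega> \<in> space M" for \<omega>
    using X Y that by (auto simp: square_integrable_vec_def random_vec_def)
  have eq: "(P *\<^sub>v X \<omega>) $ i * (Q *\<^sub>v Y \<omega>) $ j = f \<omega>" if "\<omega> \<in> space M" for \<omega>
    using dim[OF that] P Q ij
    by (simp add: f_def mult_mat_vec_index_sum[of _ k n] mult_mat_vec_index_sum[of _ l m] sum_product ac_simps
        del: index_mult_mat_vec)
  have int: "integrable M (\<lambda>\<omega>. X \<omega> $ a * Y \<omega> $ b)" if "a < n" "b < m" for a b
    using square_integrable_vec_product[OF X Y that] .
  have "integrable M f" unfolding f_def
    by (intro Bochner_Integration.integrable_sum integrable_mult_right int) auto
  thus "integrable M (\<lambda>\<omega>. (P *\<^sub>v X \<omega>) $ i * (Q *\<^sub>v Y \<omega>) $ j)"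
    by (subst Bochner_Integration.integrable_cong[OF refl eq])
  define E where "E = expectation_mat M n m (\<lambda>\<omega>. outer_prod (X \<omega>) (Y \<omega>))"
  have Ec: "E \<in> carrier_mat n m" by (simp add: E_def expectation_mat_def)
  have E: "E $$ (a,b) = integral\<^sup>L M (\<lambda>\<omega>. X \<omega> $ a * Y \<omega> $ b)" if "a < n" "b < m" for a b
    unfolding E_def expectation_mat_def using that dim
    by (auto simp: outer_prod_def carrier_vecD[OF dim(1)] carrier_vecD[OF dim(2)]
        intro!: Bochner_Integration.integral_cong)
  have "integral\<^sup>L M (\<lambda>\<omega>. (P *\<^sub>v X \<omega>) $ i * (Q *\<^sub>v Y \<omega>) $ j) = integral\<^sup>L M f"
    by (rule Bochner_Integration.integral_cong[OF refl eq])
  also have "\<dots> = (\<Sum>a<n. \<Sum>b<m. P $$ (i,a) * Q $$ (j,b) * E $$ (a,b))"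
    unfolding f_def
    by (intro has_bochner_integral_integral_eq has_bochner_integral_sum has_bochner_integral_mult_right)
      (auto simp: E intro!: has_bochner_integral_integrable int)
  also have "\<dots> = (\<Sum>b<m. (\<Sum>a<n. P $$ (i,a) * E $$ (a,b)) * Q $$ (j,b))"
    by (subst sum.swap) (simp add: sum_distrib_left sum_distrib_right ac_simps)
  also have "\<dots> = (P * E * transpose_mat Q) $$ (i,j)"
    using P Q Ec ij by (simp add: scalar_prod_def lessThan_atLeast0 del: assoc_mult_mat)
  finally show "integral\<^sup>L M (\<lambda>\<omega>. (P *\<^sub>v X \<omega>) $ i * (Q *\<^sub>v Y \<omega>) $ j) =
      (P * expectation_mat M n m (\<lambda>\<omega>. outer_prod (X \<omega>) (Y \<omega>)) * transpose_mat Q) $$ (i,j)"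
    unfolding E_def .
qed

lemma (in prob_space) expectation_vec_mult_add:
  assumes X: "square_integrable_vec M n X" and Y: "square_integrable_vec M m Y"
    and P: "P \<in> carrier_mat k n" and Q: "Q \<in> carrier_mat k m"
  shows "expectation_vec M k (\<lambda>\<omega>. P *\<^sub>v X \<omega> + Q *\<^sub>v Y \<omega>) =
    P *\<^sub>v expectation_vec M n X + Q *\<^sub>v expectation_vec M m Y"
proof
  fix i assume "i < dim_vec (P *\<^sub>v expectation_vec M n X + Q *\<^sub>v expectation_vec M m Y)"
  hence i: "i < k" using Q by simp
  have intX: "integrable M (\<lambda>\<omega>. X \<omega> $ a)" if "a < n" for a using square_integrable_vec_integrable[OF X that] .
  have intY: "integrable M (\<lambda>\<omega>. Y \<omega> $ b)" if "b < m" for b using square_integrable_vec_integrable[OF Y that] .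
  have "expectation_vec M k (\<lambda>\<omega>. P *\<^sub>v X \<omega> + Q *\<^sub>v Y \<omega>) $ i = integral\<^sup>L M (\<lambda>\<omega>. (P *\<^sub>v X \<omega> + Q *\<^sub>v Y \<omega>) $ i)"
    using i by (simp add: expectation_vec_def)
  also have "\<dots> = integral\<^sup>L M (\<lambda>\<omega>. (\<Sum>a<n. P $$ (i,a) * X \<omega> $ a) + (\<Sum>b<m. Q $$ (i,b) * Y \<omega> $ b))"
  proof (rule Bochner_Integration.integral_cong[OF refl])
    fix \<omega> assume "\<omega> \<in> space M"
    hence "X \<omega> \<in> carrier_vec n" "Y \<omega> \<in> carrier_vec m"
      using X Y by (auto simp: square_integrable_vec_def random_vec_def)
    thus "(P *\<^sub>v X \<omega> + Q *\<^sub>v Y \<omega>) $ i = (\<Sum>a<n. P $$ (i,a) * X \<omega> $ a) + (\<Sum>b<m. Q $$ (i,b) * Y \<omega> $ b)"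
      using P Q i by (simp add: scalar_prod_def lessThan_atLeast0)
  qed
  also have "\<dots> = (\<Sum>a<n. P $$ (i,a) * integral\<^sup>L M (\<lambda>\<omega>. X \<omega> $ a)) + (\<Sum>b<m. Q $$ (i,b) * integral\<^sup>L M (\<lambda>\<omega>. Y \<omega> $ b))"
    by (intro has_bochner_integral_integral_eq has_bochner_integral_add has_bochner_integral_sum
        has_bochner_integral_mult_right has_bochner_integral_integrable intX intY) auto
  also have "\<dots> = (P *\<^sub>v expectation_vec M n X + Q *\<^sub>v expectation_vec M m Y) $ i"
    using P Q i by (simp add: expectation_vec_def scalar_prod_def lessThan_atLeast0)
  finally show "expectation_vec M k (\<lambda>\<omega>. P *\<^sub>v X \<omega> + Q *\<^sub>v Y \<omega>) $ i =
    (P *\<^sub>v expectation_vec M n X + Q *\<^sub>v expectation_vec M m Y) $ i" .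
qed (use Q in \<open>simp add: expectation_vec_def\<close>)

text \<open>Of the four terms of the expanded outer product, the two mixed ones have expectation 0,
  since their cross moment is a zero matrix between constant factors.\<close>

lemma expectation_mat_outer_prod_uncorrelated:
  assumes X: "square_integrable_vec M n X" and Y: "square_integrable_vec M m Y"
    and P: "P \<in> carrier_mat k n" and Q: "Q \<in> carrier_mat k m"
    and XY: "expectation_mat M n m (\<lambda>\<omega>. outer_prod (X \<omega>) (Y \<omega>)) = 0\<^sub>m n m"
  shows "expectation_mat M k k (\<lambda>\<omega>. outer_prod (P *\<^sub>v X \<omega> + Q *\<^sub>v Y \<omega>) (P *\<^sub>v X \<omega> + Q *\<^sub>v Y \<omega>)) =
    P * expectation_mat M n n (\<lambda>\<omega>. outer_prod (X \<omega>) (X \<omega>)) * transpose_mat P +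
    Q * expectation_mat M m m (\<lambda>\<omega>. outer_prod (Y \<omega>) (Y \<omega>)) * transpose_mat Q"
    (is "?E = ?R")
proof
  show "dim_row ?E = dim_row ?R" "dim_col ?E = dim_col ?R" using Q by (auto simp: expectation_mat_def)
  fix i j assume "i < dim_row ?R" "j < dim_col ?R"
  hence ij: "i < k" "j < k" using Q by auto
  \<comment> \<open>The indices are left free: the mixed term with its factors in the other order is
    covered by the pair \<open>(j, i)\<close>.\<close>
  have XY0: "integral\<^sup>L M (\<lambda>\<omega>. (P *\<^sub>v X \<omega>) $ i' * (Q *\<^sub>v Y \<omega>) $ j') = 0" if "i' < k" "j' < k" for i' j'
    using integral_mult_mat_vec_product(2)[OF X Y P Q that] P Q that unfolding XY
    by (simp add: right_mult_zero_mat[of P k n m] left_mult_zero_mat[of "transpose_mat Q" m k])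
  note I = integral_mult_mat_vec_product(1)[OF X X P P ij] integral_mult_mat_vec_product(1)[OF X Y P Q ij]
    integral_mult_mat_vec_product(1)[OF X Y P Q ij(2,1)] integral_mult_mat_vec_product(1)[OF Y Y Q Q ij]
  have "?E $$ (i,j) = integral\<^sup>L M (\<lambda>\<omega>. (P *\<^sub>v X \<omega>) $ i * (P *\<^sub>v X \<omega>) $ j + (P *\<^sub>v X \<omega>) $ i * (Q *\<^sub>v Y \<omega>) $ j
      + (P *\<^sub>v X \<omega>) $ j * (Q *\<^sub>v Y \<omega>) $ i + (Q *\<^sub>v Y \<omega>) $ i * (Q *\<^sub>v Y \<omega>) $ j)"
    using ij P Q by (simp add: expectation_mat_def outer_prod_def algebra_simps)
  also have "\<dots> = (P * expectation_mat M n n (\<lambda>\<omega>. outer_prod (X \<omega>) (X \<omega>)) * transpose_mat P) $$ (i,j) +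
      (Q * expectation_mat M m m (\<lambda>\<omega>. outer_prod (Y \<omega>) (Y \<omega>)) * transpose_mat Q) $$ (i,j)"
    using I XY0[OF ij] XY0[OF ij(2,1)] integral_mult_mat_vec_product(2)[OF X X P P ij]
      integral_mult_mat_vec_product(2)[OF Y Y Q Q ij]
    by (simp add: Bochner_Integration.integral_add Bochner_Integration.integrable_add del: index_mult_mat index_mult_mat_vec)
  also have "\<dots> = ?R $$ (i,j)" using ij P Q by simp
  finally show "?E $$ (i,j) = ?R $$ (i,j)" .
qed

section \<open>Random vectors with a constant block on top\<close>

text \<open>Serves both the augmented initial state (\<open>c\<close> all ones, \<open>\<mu>\<close>
  zero) and its deviation from the mean (\<open>c\<close> zero). The equation for \<open>Z\<close>
  is asked for on \<open>space M\<close> only, as the dimension of \<open>X \<omega>\<close> is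
  known only there.\<close>

lemma (in prob_space) square_integrable_vec_append_centered:
  assumes X: "square_integrable_vec M n X" and c: "c \<in> carrier_vec m" and \<mu>: "\<mu> \<in> carrier_vec n"
    and Z: "\<And>\<omega>. \<omega> \<in> space M \<Longrightarrow> Z \<omega> = c @\<^sub>v (X \<omega> - \<mu>)"
  shows "square_integrable_vec M (m + n) Z"
proof -
  have Xd: "X \<omega> \<in> carrier_vec n" if "\<omega> \<in> space M" for \<omega>
    using X that by (auto simp: square_integrable_vec_def random_vec_def)
  have "(\<lambda>\<omega>. Z \<omega> $ i) \<in> borel_measurable M \<and> integrable M (\<lambda>\<omega>. (Z \<omega> $ i)\<^sup>2)" if i: "i < m + n" for i
  proof -
    define f where "f \<omega> = (if i < m then c $ i else X \<omega> $ (i - m) - \<mu> $ (i - m))" for \<omega>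
    have Zf: "Z \<omega> $ i = f \<omega>" if "\<omega> \<in> space M" for \<omega>
      using that Xd i c \<mu> by (auto simp: Z f_def)
    have "f \<in> borel_measurable M \<and> integrable M (\<lambda>\<omega>. (f \<omega>)\<^sup>2)"
    proof (cases "i < m")
      case False
      define k where "k = i - m"
      have k: "k < n" using False i by (simp add: k_def)
      have "integrable M (\<lambda>\<omega>. (X \<omega> $ k)\<^sup>2 - 2 * \<mu> $ k * X \<omega> $ k + (\<mu> $ k)\<^sup>2)"
        using X square_integrable_vec_integrable[OF X k] k by (simp add: square_integrable_vec_def)
      hence "integrable M (\<lambda>\<omega>. (X \<omega> $ k - \<mu> $ k)\<^sup>2)" by (simp add: power2_diff algebra_simps)
      moreover have "(\<lambda>\<omega>. X \<omega> $ k) \<in> borel_measurable M"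
        using X k by (simp add: square_integrable_vec_def random_vec_def)
      moreover have "f = (\<lambda>\<omega>. X \<omega> $ k - \<mu> $ k)" using False by (auto simp: f_def k_def)
      ultimately show ?thesis by simp
    next
      case True
      hence "f = (\<lambda>\<omega>. c $ i)" by (auto simp: f_def)
      thus ?thesis by simp
    qed
    thus ?thesis
      using measurable_cong[of M "\<lambda>\<omega>. Z \<omega> $ i" f borel]
        Bochner_Integration.integrable_cong[of M M "\<lambda>\<omega>. (Z \<omega> $ i)\<^sup>2" "\<lambda>\<omega>. (f \<omega>)\<^sup>2"] Zf by simp
  qed
  moreover have "Z \<omega> \<in> carrier_vec (m + n)" if "\<omega> \<in> space M" for \<omega>
    by (rule carrier_vecI) (use that c \<mu> in \<open>simp add: Z\<close>)
  ultimately show ?thesis by (simp add: square_integrable_vec_def random_vec_def)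
qed

lemma (in prob_space) expectation_vec_append_const:
  assumes X: "random_vec M n X" and c: "c \<in> carrier_vec m"
  shows "expectation_vec M (m + n) (\<lambda>\<omega>. c @\<^sub>v X \<omega>) = c @\<^sub>v expectation_vec M n X"
proof
  fix i assume "i < dim_vec (c @\<^sub>v expectation_vec M n X)"
  hence i: "i < m + n" using c by (simp add: expectation_vec_def)
  have "expectation (\<lambda>\<omega>. (c @\<^sub>v X \<omega>) $ i) = expectation (\<lambda>\<omega>. if i < m then c $ i else X \<omega> $ (i - m))"
    using i X c by (intro Bochner_Integration.integral_cong) (auto simp: random_vec_def)
  also have "\<dots> = (c @\<^sub>v expectation_vec M n X) $ i"
    using i c by (cases "i < m") (auto simp: expectation_vec_def prob_space)
  finally show "expectation_vec M (m + n) (\<lambda>\<omega>. c @\<^sub>v X \<omega>) $ i = (c @\<^sub>v expectation_vec M n X) $ i"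
    using i by (simp add: expectation_vec_def)
qed (use c in \<open>simp add: expectation_vec_def\<close>)

lemma expectation_vec_cong:
  assumes "\<And>\<omega>. \<omega> \<in> space M \<Longrightarrow> X \<omega> = Y \<omega>"
  shows "expectation_vec M n X = expectation_vec M n Y"
  using assms by (simp add: expectation_vec_def cong: Bochner_Integration.integral_cong)

lemma expectation_mat_append_zero_centered:
  assumes \<mu>: "\<mu> \<in> carrier_vec n"
  shows "expectation_mat M (m + n) (m + n)
      (\<lambda>\<omega>. outer_prod (0\<^sub>v m @\<^sub>v (X \<omega> - \<mu>)) (0\<^sub>v m @\<^sub>v (X \<omega> - \<mu>))) =
    four_block_mat (0\<^sub>m m m) (0\<^sub>m m n) (0\<^sub>m n m)
      (expectation_mat M n n (\<lambda>\<omega>. outer_prod (X \<omega> - \<mu>) (X \<omega> - \<mu>)))"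
    (is "?L = ?R")
proof
  show "dim_row ?L = dim_row ?R" "dim_col ?L = dim_col ?R" by (auto simp: expectation_mat_def)
  fix i j assume "i < dim_row ?R" "j < dim_col ?R"
  hence ij: "i < m + n" "j < m + n" by (auto simp: expectation_mat_def)
  \<comment> \<open>The difference \<open>X \<omega> - \<mu>\<close> takes its dimension from
    \<open>\<mu>\<close>, so the entries can be compared for every \<open>\<omega>\<close>.\<close>
  have "outer_prod (0\<^sub>v m @\<^sub>v (X \<omega> - \<mu>)) (0\<^sub>v m @\<^sub>v (X \<omega> - \<mu>)) $$ (i,j) =
      (if i < m \<or> j < m then 0 else outer_prod (X \<omega> - \<mu>) (X \<omega> - \<mu>) $$ (i - m, j - m))" for \<omega>
    using \<mu> ij by (auto simp: outer_prod_def)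
  thus "?L $$ (i,j) = ?R $$ (i,j)" using ij by (auto simp: expectation_mat_def)
qed

text \<open>Centring \<open>X\<close> changes its cross moment with \<open>W\<close> only by a
  multiple of the mean of \<open>W\<close>, which is 0.\<close>

lemma (in prob_space) expectation_mat_append_zero_centered_uncorrelated:
  assumes \<mu>: "\<mu> \<in> carrier_vec n"
    and X: "square_integrable_vec M n X" and W: "square_integrable_vec M k W"
    and W_mean: "expectation_vec M k W = 0\<^sub>v k"
    and XW: "expectation_mat M n k (\<lambda>\<omega>. outer_prod (X \<omega>) (W \<omega>)) = 0\<^sub>m n k"
  shows "expectation_mat M (m + n) k (\<lambda>\<omega>. outer_prod (0\<^sub>v m @\<^sub>v (X \<omega> - \<mu>)) (W \<omega>)) = 0\<^sub>m (m + n) k"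
    (is "?L = ?R")
proof
  show "dim_row ?L = dim_row ?R" "dim_col ?L = dim_col ?R" by (auto simp: expectation_mat_def)
  fix i j assume "i < dim_row ?R" "j < dim_col ?R"
  hence ij: "i < m + n" "j < k" by auto
  have dim: "dim_vec (X \<omega>) = n" "dim_vec (W \<omega>) = k" if "\<omega> \<in> space M" for \<omega>
    using X W that by (auto simp: square_integrable_vec_def random_vec_def)
  have "expectation (\<lambda>\<omega>. outer_prod (0\<^sub>v m @\<^sub>v (X \<omega> - \<mu>)) (W \<omega>) $$ (i,j)) = 0"
  proof (cases "i < m")
    case True
    have "expectation (\<lambda>\<omega>. outer_prod (0\<^sub>v m @\<^sub>v (X \<omega> - \<mu>)) (W \<omega>) $$ (i,j)) = expectation (\<lambda>_. 0)"
      using True ij \<mu> dim by (intro Bochner_Integration.integral_cong) (auto simp: outer_prod_def)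
    thus ?thesis by simp
  next
    case False
    define a where "a = i - m"
    have a: "a < n" using False ij by (simp add: a_def)
    have "expectation (\<lambda>\<omega>. X \<omega> $ a * W \<omega> $ j) = expectation (\<lambda>\<omega>. outer_prod (X \<omega>) (W \<omega>) $$ (a,j))"
      using a ij dim by (intro Bochner_Integration.integral_cong) (auto simp: outer_prod_def)
    also have "\<dots> = 0"
      using arg_cong[OF XW, of "\<lambda>E. E $$ (a,j)"] a ij by (simp add: expectation_mat_def)
    finally have "expectation (\<lambda>\<omega>. X \<omega> $ a * W \<omega> $ j) = 0" .
    moreover have "expectation (\<lambda>\<omega>. W \<omega> $ j) = 0"
      using arg_cong[OF W_mean, of "\<lambda>v. v $ j"] ij by (simp add: expectation_vec_def)
    moreover have "expectation (\<lambda>\<omega>. outer_prod (0\<^sub>v m @\<^sub>v (X \<omega> - \<mu>)) (W \<omega>) $$ (i,j)) =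
        expectation (\<lambda>\<omega>. X \<omega> $ a * W \<omega> $ j - \<mu> $ a * W \<omega> $ j)"
      using False ij \<mu> dim
      by (intro Bochner_Integration.integral_cong) (auto simp: outer_prod_def a_def algebra_simps)
    ultimately show ?thesis
      using square_integrable_vec_product[OF X W a ij(2)] square_integrable_vec_integrable[OF W ij(2)] by simp
  qed
  thus "?L $$ (i,j) = ?R $$ (i,j)" using ij by (simp add: expectation_mat_def)
qed

section \<open>The augmented system\<close>

lemma last_block_mat_mult_vec:
  assumes v: "v \<in> carrier_vec ((N + 2) * nx)"
  shows "last_block_mat N nx *\<^sub>v v = vec_last v nx"
proof
  fix i assume "i < dim_vec (vec_last v nx)"
  hence i: "i < nx" by (simp add: vec_last_def)
  have dim: "dim_row (last_block_mat N nx) = nx" "dim_col (last_block_mat N nx) = (N + 2) * nx"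
    by (auto simp: last_block_mat_def append_cols_def)
  \<comment> \<open>The last of the \<open>N + 2\<close> blocks starts at index
    \<open>(N + 1) * nx\<close>, counted from 0.\<close>
  have "row (last_block_mat N nx) i = unit_vec ((N + 2) * nx) ((N + 1) * nx + i)"
    using i by (intro eq_vecI) (auto simp: dim last_block_mat_def append_cols_def unit_vec_def)
  thus "(last_block_mat N nx *\<^sub>v v) $ i = vec_last v nx $ i"
    using i v by (simp add: dim vec_last_def)
qed (auto simp: vec_last_def last_block_mat_def append_cols_def)

lemma last_block_mat_carrier: "last_block_mat N nx \<in> carrier_mat nx ((N + 2) * nx)"
  by (auto simp: last_block_mat_def append_cols_def)

lemma aug_state_mat_carrier: "aug_state_mat N nx A \<in> carrier_mat ((N + 2) * nx) (nx + nx)"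
  by (auto simp: aug_state_mat_def state_mat_def block_mat_def Let_def)

lemma aug_input_mat_carrier: "aug_input_mat N nx m A B \<in> carrier_mat ((N + 2) * nx) (N * m)"
  by (auto simp: aug_input_mat_def input_mat_def block_mat_def append_rows_def)


section \<open>Mean and covariance of the terminal state\<close>

theorem proposition4:
  fixes N nx nu nw :: nat
    and A B D :: "nat \<Rightarrow> real mat"
    and M :: "'a measure"
    and x0 W bX0 bX xN xN_tilde :: "'a \<Rightarrow> real vec"
    and \<mu>0 b\<mu>0 \<mu>N :: "real vec"
    and \<Sigma>0 b\<Sigma>0 \<Sigma>N bA bB bD K1 KX K EN :: "real mat"
  assumes "N > 0" and "nx > 0" and "nu > 0" and "nw > 0"
    and "\<And>k. k < N \<Longrightarrow> A k \<in> carrier_mat nx nx"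
    and "\<And>k. k < N \<Longrightarrow> B k \<in> carrier_mat nx nu"
    and "\<And>k. k < N \<Longrightarrow> D k \<in> carrier_mat nx nw"
    and "bA = aug_state_mat N nx A"
    and "bB = aug_input_mat N nx nu A B"
    and "bD = aug_input_mat N nx nw A D"
    and "prob_space M"
    and "\<mu>0 \<in> carrier_vec nx" and "pos_semidef nx \<Sigma>0"
    and "normal_vec M nx x0 \<mu>0 \<Sigma>0"
    and "gaussian_vec M (N * nw) W"
    and "expectation_vec M (N * nw) W = 0\<^sub>v (N * nw)"
    and "expectation_mat M (N * nw) (N * nw) (\<lambda>\<omega>. outer_prod (W \<omega>) (W \<omega>)) = 1\<^sub>m (N * nw)"
    and "expectation_mat M nx (N * nw) (\<lambda>\<omega>. outer_prod (x0 \<omega>) (W \<omega>)) = 0\<^sub>m nx (N * nw)"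
    and "bX0 = (\<lambda>\<omega>. ones_vec nx @\<^sub>v x0 \<omega>)"
    and "b\<mu>0 = ones_vec nx @\<^sub>v \<mu>0"
    and "b\<Sigma>0 = four_block_mat (0\<^sub>m nx nx) (0\<^sub>m nx nx) (0\<^sub>m nx nx) \<Sigma>0"
    and "K1 \<in> carrier_mat (N * nu) nx"
    and "KX \<in> carrier_mat (N * nu) ((N + 1) * nx)" and "lower_block_triangular nu nx KX"
    and "K = append_cols K1 KX"
    and "bX = (\<lambda>\<omega>. (1\<^sub>m ((N + 2) * nx) + bB * K) *\<^sub>v (bA *\<^sub>v bX0 \<omega> + bD *\<^sub>v W \<omega>))"
    and "xN = (\<lambda>\<omega>. vec_last (bX \<omega>) nx)"
    and "xN_tilde = (\<lambda>\<omega>. xN \<omega> - expectation_vec M nx xN)"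
    and "\<mu>N \<in> carrier_vec nx" and "pos_def nx \<Sigma>N"
    and "EN = last_block_mat N nx"
  shows "(expectation_vec M nx xN = \<mu>N \<longleftrightarrow>
            \<mu>N = EN * (1\<^sub>m ((N + 2) * nx) + bB * K) * bA *\<^sub>v b\<mu>0)
       \<and> (loewner_le nx (expectation_mat M nx nx (\<lambda>\<omega>. outer_prod (xN_tilde \<omega>) (xN_tilde \<omega>))) \<Sigma>N \<longleftrightarrow>
            1 - matrix_norm2 (psd_sqrt (bA * b\<Sigma>0 * transpose_mat bA + bD * transpose_mat bD)
                   * transpose_mat (1\<^sub>m ((N + 2) * nx) + bB * K)
                   * transpose_mat EN * inv_sqrt \<Sigma>N) \<ge> 0)"
proof -
  note bA_def = assms(8) and bB_def = assms(9) and bD_def = assms(10) and bX0_def = assms(19)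
    and b\<mu>0_def = assms(20) and b\<Sigma>0_def = assms(21) and K_def = assms(25) and bX_def = assms(26)
    and xN_def = assms(27) and xN_tilde_def = assms(28) and EN_def = assms(31)
  interpret prob_space M by fact
  let ?m = "(N + 2) * nx"
  note nx = \<open>nx > 0\<close> and \<Sigma>N = \<open>pos_def nx \<Sigma>N\<close>
  have \<mu>0: "\<mu>0 \<in> carrier_vec nx" by fact
  have x0: "square_integrable_vec M nx x0"
    and x0_mean: "expectation_vec M nx x0 = \<mu>0"
    and x0_cov: "expectation_mat M nx nx (\<lambda>\<omega>. outer_prod (x0 \<omega> - \<mu>0) (x0 \<omega> - \<mu>0)) = \<Sigma>0"
    using \<open>normal_vec M nx x0 \<mu>0 \<Sigma>0\<close> gaussian_vec_square_integrable by (auto simp: normal_vec_def)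
  have W: "square_integrable_vec M (N * nw) W"
    using \<open>gaussian_vec M (N * nw) W\<close> by (rule gaussian_vec_square_integrable)
  note W_mean = \<open>expectation_vec M (N * nw) W = 0\<^sub>v (N * nw)\<close>
  note W_cov = \<open>expectation_mat M (N * nw) (N * nw) (\<lambda>\<omega>. outer_prod (W \<omega>) (W \<omega>)) = 1\<^sub>m (N * nw)\<close>
  note x0W = \<open>expectation_mat M nx (N * nw) (\<lambda>\<omega>. outer_prod (x0 \<omega>) (W \<omega>)) = 0\<^sub>m nx (N * nw)\<close>
  have x0_dim: "x0 \<omega> \<in> carrier_vec nx" and W_dim: "W \<omega> \<in> carrier_vec (N * nw)" if "\<omega> \<in> space M" for \<omega>
    using x0 W that by (auto simp: square_integrable_vec_def random_vec_def)
  have ones: "ones_vec nx \<in> carrier_vec nx" by (simp add: ones_vec_def)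

  have bA: "bA \<in> carrier_mat ?m (nx + nx)" unfolding bA_def by (rule aug_state_mat_carrier)
  have bB: "bB \<in> carrier_mat ?m (N * nu)" unfolding bB_def by (rule aug_input_mat_carrier)
  have bD: "bD \<in> carrier_mat ?m (N * nw)" unfolding bD_def by (rule aug_input_mat_carrier)
  have EN: "EN \<in> carrier_mat nx ?m" unfolding EN_def by (rule last_block_mat_carrier)
  have K: "K \<in> carrier_mat (N * nu) ?m"
    unfolding K_def append_cols_def
    using \<open>K1 \<in> carrier_mat (N * nu) nx\<close> \<open>KX \<in> carrier_mat (N * nu) ((N + 1) * nx)\<close> by auto
  define L where "L = 1\<^sub>m ?m + bB * K"
  have L: "L \<in> carrier_mat ?m ?m" using bB K by (simp add: L_def)
  define G where "G = EN * L"
  have G: "G \<in> carrier_mat nx ?m" using EN L by (simp add: G_def)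
  \<comment> \<open>\<open>P\<close> and \<open>Q\<close> are the maps through which the augmented
    initial state and the noise enter the terminal state.\<close>
  define P where "P = G * bA"
  have P: "P \<in> carrier_mat nx (nx + nx)" using G bA by (simp add: P_def)
  define Q where "Q = G * bD"
  have Q: "Q \<in> carrier_mat nx (N * nw)" using G bD by (simp add: Q_def)
  have b\<mu>0: "b\<mu>0 \<in> carrier_vec (nx + nx)" using \<mu>0 ones by (simp add: b\<mu>0_def)
  have bX0_dim: "bX0 \<omega> \<in> carrier_vec (nx + nx)" if "\<omega> \<in> space M" for \<omega>
    using x0_dim[OF that] ones by (simp add: bX0_def)

  have xN: "xN \<omega> = P *\<^sub>v bX0 \<omega> + Q *\<^sub>v W \<omega>" if "\<omega> \<in> space M" for \<omega>
  proof -
    note d = bX0_dim[OF that] W_dim[OF that]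
    have "xN \<omega> = EN *\<^sub>v (L *\<^sub>v (bA *\<^sub>v bX0 \<omega> + bD *\<^sub>v W \<omega>))"
      unfolding xN_def EN_def using d bA bD L
      by (subst last_block_mat_mult_vec) (auto simp: bX_def L_def)
    also have "\<dots> = G *\<^sub>v (bA *\<^sub>v bX0 \<omega> + bD *\<^sub>v W \<omega>)"
      unfolding G_def using d bA bD by (subst assoc_mult_mat_vec[OF EN L]) auto
    also have "\<dots> = P *\<^sub>v bX0 \<omega> + Q *\<^sub>v W \<omega>"
      using d bA bD G by (simp add: P_def Q_def mult_add_distrib_mat_vec[of _ nx ?m])
    finally show ?thesis .
  qed

  \<comment> \<open>The deviation of the augmented initial state from its mean; the block of ones
    deviates by 0.\<close>
  define Y where "Y = (\<lambda>\<omega>. 0\<^sub>v nx @\<^sub>v (x0 \<omega> - \<mu>0))"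
  have Y: "square_integrable_vec M (nx + nx) Y"
    by (rule square_integrable_vec_append_centered[OF x0 zero_carrier_vec \<mu>0]) (simp add: Y_def)
  have Y_dim: "Y \<omega> \<in> carrier_vec (nx + nx)" for \<omega>
    by (rule carrier_vecI) (use \<mu>0 in \<open>simp add: Y_def\<close>)
  have bX0: "bX0 \<omega> = b\<mu>0 + Y \<omega>" if "\<omega> \<in> space M" for \<omega>
  proof
    fix i assume "i < dim_vec (b\<mu>0 + Y \<omega>)"
    hence "i < nx + nx" using Y_dim[of \<omega>] by simp
    thus "bX0 \<omega> $ i = (b\<mu>0 + Y \<omega>) $ i"
      using x0_dim[OF that] \<mu>0 ones unfolding bX0_def b\<mu>0_def Y_def by auto
  qed (use Y_dim[of \<omega>] bX0_dim[OF that] in simp)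
  have bX0': "square_integrable_vec M (nx + nx) bX0"
  proof (rule square_integrable_vec_append_centered[OF x0 ones zero_carrier_vec])
    fix \<omega> assume "\<omega> \<in> space M"
    thus "bX0 \<omega> = ones_vec nx @\<^sub>v (x0 \<omega> - 0\<^sub>v nx)" using x0_dim[of \<omega>] by (simp add: bX0_def)
  qed
  have bX0_mean: "expectation_vec M (nx + nx) bX0 = b\<mu>0"
    unfolding bX0_def b\<mu>0_def x0_mean[symmetric]
    using x0 ones by (intro expectation_vec_append_const) (simp_all add: square_integrable_vec_def)
  have mean: "expectation_vec M nx xN = P *\<^sub>v b\<mu>0"
  proof -
    have "expectation_vec M nx xN = expectation_vec M nx (\<lambda>\<omega>. P *\<^sub>v bX0 \<omega> + Q *\<^sub>v W \<omega>)"
      using xN by (rule expectation_vec_cong)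
    also have "\<dots> = P *\<^sub>v b\<mu>0 + Q *\<^sub>v 0\<^sub>v (N * nw)"
      using expectation_vec_mult_add[OF bX0' W P Q] by (simp add: bX0_mean W_mean)
    also have "\<dots> = P *\<^sub>v b\<mu>0" using P Q b\<mu>0 by auto
    finally show ?thesis .
  qed

  have YY: "expectation_mat M (nx + nx) (nx + nx) (\<lambda>\<omega>. outer_prod (Y \<omega>) (Y \<omega>)) = b\<Sigma>0"
    unfolding Y_def b\<Sigma>0_def using expectation_mat_append_zero_centered[OF \<mu>0, of M nx x0] by (simp only: x0_cov)
  have YW: "expectation_mat M (nx + nx) (N * nw) (\<lambda>\<omega>. outer_prod (Y \<omega>) (W \<omega>)) = 0\<^sub>m (nx + nx) (N * nw)"
    unfolding Y_def by (rule expectation_mat_append_zero_centered_uncorrelated[OF \<mu>0 x0 W W_mean x0W])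

  define S where "S = bA * b\<Sigma>0 * transpose_mat bA + bD * transpose_mat bD"
  \<comment> \<open>Subtracting the mean leaves the deviation \<open>Y\<close> and the noise, which
    is already centred.\<close>
  have xN_tilde: "xN_tilde \<omega> = P *\<^sub>v Y \<omega> + Q *\<^sub>v W \<omega>" if "\<omega> \<in> space M" for \<omega>
  proof -
    have "xN_tilde \<omega> = P *\<^sub>v (b\<mu>0 + Y \<omega>) + Q *\<^sub>v W \<omega> - P *\<^sub>v b\<mu>0"
      using that by (simp add: xN_tilde_def mean xN bX0)
    also have "P *\<^sub>v (b\<mu>0 + Y \<omega>) = P *\<^sub>v b\<mu>0 + P *\<^sub>v Y \<omega>"
      by (rule mult_add_distrib_mat_vec[OF P b\<mu>0 Y_dim])
    also have "P *\<^sub>v b\<mu>0 + P *\<^sub>v Y \<omega> + Q *\<^sub>v W \<omega> - P *\<^sub>v b\<mu>0 = P *\<^sub>v Y \<omega> + Q *\<^sub>v W \<omega>"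
      using P Q by (intro eq_vecI) (auto simp del: index_mult_mat_vec)
    finally show ?thesis .
  qed
  have b\<Sigma>0: "pos_semidef (nx + nx) b\<Sigma>0"
    unfolding b\<Sigma>0_def using \<open>pos_semidef nx \<Sigma>0\<close> by (rule pos_semidef_zero_block)
  hence b\<Sigma>0c: "b\<Sigma>0 \<in> carrier_mat (nx + nx) (nx + nx)" by (simp add: pos_semidef_def)
  \<comment> \<open>The noise term is read as a congruence of the identity matrix, the covariance of
    \<open>W\<close>.\<close>
  have S: "pos_semidef ?m S"
    using pos_semidef_add[OF pos_semidef_congruence[OF b\<Sigma>0 bA] pos_semidef_congruence[OF pos_semidef_one bD]] bD
    by (simp add: S_def right_mult_one_mat[OF bD])
  have "expectation_mat M nx nx (\<lambda>\<omega>. outer_prod (xN_tilde \<omega>) (xN_tilde \<omega>)) =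
      expectation_mat M nx nx (\<lambda>\<omega>. outer_prod (P *\<^sub>v Y \<omega> + Q *\<^sub>v W \<omega>) (P *\<^sub>v Y \<omega> + Q *\<^sub>v W \<omega>))"
    using xN_tilde by (simp add: expectation_mat_def cong: Bochner_Integration.integral_cong)
  also have "\<dots> = P * b\<Sigma>0 * transpose_mat P + Q * 1\<^sub>m (N * nw) * transpose_mat Q"
    using expectation_mat_outer_prod_uncorrelated[OF Y W P Q YW] by (simp only: YY W_cov)
  \<comment> \<open>The identity covariance of \<open>W\<close> drops out, and \<open>G\<close> is
    pulled out of either term.\<close>
  also have "\<dots> = G * (bA * b\<Sigma>0 * transpose_mat bA) * transpose_mat G + G * (bD * transpose_mat bD) * transpose_mat G"
    unfolding P_def Q_def using mult_congruence[OF G bA b\<Sigma>0c] mult_congruence[OF G bD one_carrier_mat]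
    by (simp only: right_mult_one_mat[OF bD])
  also have "\<dots> = G * S * transpose_mat G"
  proof -
    have c: "bA * b\<Sigma>0 * transpose_mat bA \<in> carrier_mat ?m ?m" "bD * transpose_mat bD \<in> carrier_mat ?m ?m"
      using bA bD b\<Sigma>0c by auto
    have Gt: "transpose_mat G \<in> carrier_mat ?m nx" using G by simp
    show ?thesis
      unfolding S_def mult_add_distrib_mat[OF G c]
        add_mult_distrib_mat[OF mult_carrier_mat[OF G c(1)] mult_carrier_mat[OF G c(2)] Gt] ..
  qed
  finally have cov: "expectation_mat M nx nx (\<lambda>\<omega>. outer_prod (xN_tilde \<omega>) (xN_tilde \<omega>)) = G * S * transpose_mat G" .
  have sqrtS: "psd_sqrt S \<in> carrier_mat ?m ?m" using psd_sqrt(1)[OF S] by (simp add: pos_semidef_def)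
  \<comment> \<open>Transposing \<open>G\<close> reverses its factors, so the matrix in the norm
    constraint is that of the general criterion with \<open>G\<close> in place of
    \<open>F\<close>.\<close>
  have "psd_sqrt S * transpose_mat L * transpose_mat EN = psd_sqrt S * transpose_mat G"
    using sqrtS L EN by (simp add: G_def transpose_mult[OF EN L] assoc_mult_mat[of _ ?m ?m _ ?m _ nx])
  moreover have "P *\<^sub>v b\<mu>0 = \<mu>N \<longleftrightarrow> \<mu>N = EN * L * bA *\<^sub>v b\<mu>0" by (auto simp: P_def G_def)
  ultimately show ?thesis
    unfolding mean cov L_def[symmetric] S_def[symmetric] loewner_le_iff_matrix_norm2[OF S G \<Sigma>N nx]
    by simp
qed

end
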